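(* Let $q\in(1/2,1)$ and let $\overline g$ be an asymptotically flat Riemannian metric on a three-dimensional manifold, with scalar curvature $R_{\overline g}=0$ and energy $E\ne0$, which for some constant $A$ satisfies in its asymptotically flat chart $$\overline g_{ij}=\left(1+\frac Ar\right)\delta_{ij}+\frac{\alpha}{r}\left(\frac{x_ix_j}{r^2}-\frac12\delta_{ij}\right)+O_2(r^{-1-q}),\qquad \alpha=\frac{x_1}{r}.$$ Then the first component $\mathbf{C}_1$ of the center of mass of $\overline g$ is infinite, i.e. the integrals whose limit defines $\mathbf{C}_1$ diverge to infinity in absolute value as $\rho\to\infty$.
   Context: Asymptotically flat: outside a compact set the manifold is diffeomorphic to $\mathbb{R}^3\setminus B_1$, with a chart $\{x\}$ in which the metric is $\delta_{ij}+O_2(r^{-s})$ for some $s>1/2$, $r=|x|$. Here $f=O_k(r^{-s})$ means $|\partial^\gamma f|\le Cr^{-s-|\gamma|}$ for all $|\gamma|\le k$ and large $r$; commas denote partial derivatives; $dS$ is the standard Euclidean surface measure. The energy is $$E=\frac1{16\pi}\lim_{\rho\to\infty}\int_{r=\rho}\sum_{i,j}(g_{ij,i}-g_{ii,j})\frac{x_j}{r}\,dS,$$ and the center of mass is, for $l=1,2,3$, $$\mathbf{C}_l=\frac1{16\pi E}\lim_{\rho\to\infty}\int_{r=\rho}\Big[x_l\sum_{i,j}(g_{ij,i}-g_{ii,j})\frac{x_j}{r}-\sum_i\Big(g_{il}\frac{x_i}{r}-g_{ii}\frac{x_l}{r}\Big)\Big]\,dS.$$ *)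

theory Defs
  imports "HOL-Analysis.Analysis"
begin

section \<open>Partial derivatives, differentiability classes and decay\<close>

definition partial_deriv :: "3 \<Rightarrow> (real^3 \<Rightarrow> real) \<Rightarrow> real^3 \<Rightarrow> real" where
  "partial_deriv i f x = deriv (\<lambda>t. f (x + t *\<^sub>R axis i 1)) 0"

text \<open>An iterated partial derivative is given by the list of its differentiation indices; its
  order is the length of the list. On \<open>C\<^sup>k\<close> functions these lists, up to permutation, are
  the multi-indices of order at most \<open>k\<close>.\<close>

primrec iter_partial_deriv :: "3 list \<Rightarrow> (real^3 \<Rightarrow> real) \<Rightarrow> real^3 \<Rightarrow> real" where
  "iter_partial_deriv [] f = f"
| "iter_partial_deriv (i # is) f = partial_deriv i (iter_partial_deriv is f)"

text \<open>To be used for open \<open>S\<close> only.\<close>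

primrec Ck_on :: "nat \<Rightarrow> (real^3 \<Rightarrow> real) \<Rightarrow> (real^3) set \<Rightarrow> bool" where
  "Ck_on 0 f S \<longleftrightarrow> continuous_on S f"
| "Ck_on (Suc k) f S \<longleftrightarrow>
     (\<forall>x\<in>S. f differentiable (at x)) \<and> (\<forall>i. Ck_on k (partial_deriv i f) S)"

definition smooth_on :: "(real^3 \<Rightarrow> real) \<Rightarrow> (real^3) set \<Rightarrow> bool" where
  "smooth_on f S \<longleftrightarrow> (\<forall>k. Ck_on k f S)"

text \<open>\<open>big_O_deriv k s f\<close> says that \<open>f = O\<^sub>k(r\<^bsup>-s\<^esup>)\<close>. The values of \<open>f\<close> near the
  origin are irrelevant.\<close>

definition big_O_deriv :: "nat \<Rightarrow> real \<Rightarrow> (real^3 \<Rightarrow> real) \<Rightarrow> bool" where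
  "big_O_deriv k s f \<longleftrightarrow>
     (\<exists>C r0. Ck_on k f {x. norm x > r0} \<and>
        (\<forall>is x. length is \<le> k \<longrightarrow> norm x > r0 \<longrightarrow>
           \<bar>iter_partial_deriv is f x\<bar> \<le> C * norm x powr (- s - real (length is))))"


section \<open>Curvature of a metric given in coordinates\<close>

type_synonym metric_coeffs = "real^3 \<Rightarrow> real^3^3"

text \<open>\<open>dmet g k i j x\<close> is \<open>g\<^bsub>ij,k\<^esub>(x)\<close>.\<close>

definition dmet :: "metric_coeffs \<Rightarrow> 3 \<Rightarrow> 3 \<Rightarrow> 3 \<Rightarrow> real^3 \<Rightarrow> real" where
  "dmet g k i j x = partial_deriv k (\<lambda>y. g y $ i $ j) x"

text \<open>\<open>christoffel g k i j\<close> is the symbol with upper index \<open>k\<close> and lower indices \<open>i\<close>, \<open>j\<close>.\<close>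

definition christoffel :: "metric_coeffs \<Rightarrow> 3 \<Rightarrow> 3 \<Rightarrow> 3 \<Rightarrow> real^3 \<Rightarrow> real" where
  "christoffel g k i j x =
     (1/2) * (\<Sum>l\<in>UNIV. matrix_inv (g x) $ k $ l *
                (dmet g i j l x + dmet g j i l x - dmet g l i j x))"

definition ricci :: "metric_coeffs \<Rightarrow> 3 \<Rightarrow> 3 \<Rightarrow> real^3 \<Rightarrow> real" where
  "ricci g i j x =
     (\<Sum>k\<in>UNIV. partial_deriv k (christoffel g k i j) x - partial_deriv j (christoffel g k i k) x
        + (\<Sum>l\<in>UNIV. christoffel g k k l x * christoffel g l i j x
                    - christoffel g k j l x * christoffel g l i k x))"

definition scalar_curvature :: "metric_coeffs \<Rightarrow> real^3 \<Rightarrow> real" where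
  "scalar_curvature g x = (\<Sum>i\<in>UNIV. \<Sum>j\<in>UNIV. matrix_inv (g x) $ i $ j * ricci g i j x)"


section \<open>Riemannian manifolds of dimension three\<close>

text \<open>A chart is its domain together with the coordinate map; values of the map outside the domain
  are irrelevant.\<close>

type_synonym 'm chart = "'m set \<times> ('m \<Rightarrow> real^3)"

definition chart_image :: "'m chart \<Rightarrow> (real^3) set" where
  "chart_image c = snd c ` fst c"

definition transition :: "'m chart \<Rightarrow> 'm chart \<Rightarrow> real^3 \<Rightarrow> real^3" where
  "transition c d x = snd d (inv_into (fst c) (snd c) x)"

definition transition_domain :: "'m chart \<Rightarrow> 'm chart \<Rightarrow> (real^3) set" where
  "transition_domain c d = snd c ` (fst c \<inter> fst d)"

text \<open>The manifold is the space \<open>X\<close> with the smooth atlas \<open>\<A>\<close>, not required to be maximal.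
  The metric tensor is given by its coefficients \<open>G c\<close> in each chart \<open>c\<close>, related by the
  transformation law of covariant 2-tensors. It is only required to be of class \<open>C\<^sup>2\<close>, which
  is what the scalar curvature needs; smooth metrics are included.\<close>

locale riemannian_3manifold =
  fixes X :: "'m topology" and \<A> :: "'m chart set" and G :: "'m chart \<Rightarrow> metric_coeffs"
  assumes hausdorff: "Hausdorff_space X"
    and second_countable: "second_countable X"
    and covers: "(\<Union>c\<in>\<A>. fst c) = topspace X"
    and chart_open: "c \<in> \<A> \<Longrightarrow> openin X (fst c) \<and> open (chart_image c)"
    and chart_homeo: "c \<in> \<A> \<Longrightarrow>
      homeomorphic_map (subtopology X (fst c)) (top_of_set (chart_image c)) (snd c)"
    and smooth_transition: "\<lbrakk>c \<in> \<A>; d \<in> \<A>\<rbrakk> \<Longrightarrow>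
      smooth_on (\<lambda>x. transition c d x $ a) (transition_domain c d)"
    and metric_C2: "c \<in> \<A> \<Longrightarrow> Ck_on 2 (\<lambda>x. G c x $ i $ j) (chart_image c)"
    and metric_sym: "\<lbrakk>c \<in> \<A>; x \<in> chart_image c\<rbrakk> \<Longrightarrow> transpose (G c x) = G c x"
    and metric_pos: "\<lbrakk>c \<in> \<A>; x \<in> chart_image c; v \<noteq> 0\<rbrakk> \<Longrightarrow> v \<bullet> (G c x *v v) > 0"
    and metric_transform: "\<lbrakk>c \<in> \<A>; d \<in> \<A>; x \<in> transition_domain c d\<rbrakk> \<Longrightarrow>
      G c x $ i $ j =
        (\<Sum>a\<in>UNIV. \<Sum>b\<in>UNIV. partial_deriv i (\<lambda>y. transition c d y $ a) x *
           partial_deriv j (\<lambda>y. transition c d y $ b) x * G d (transition c d x) $ a $ b)"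

definition scalar_flat :: "'m chart set \<Rightarrow> ('m chart \<Rightarrow> metric_coeffs) \<Rightarrow> bool" where
  "scalar_flat \<A> G \<longleftrightarrow> (\<forall>c\<in>\<A>. \<forall>x\<in>chart_image c. scalar_curvature (G c) x = 0)"

text \<open>The complement of a compact set is open in \<open>X\<close>, so the ball removed from Euclidean space is
  the closed unit ball.\<close>

definition asymptotically_flat_chart ::
    "'m topology \<Rightarrow> 'm chart set \<Rightarrow> ('m chart \<Rightarrow> metric_coeffs) \<Rightarrow> 'm chart \<Rightarrow> bool" where
  "asymptotically_flat_chart X \<A> G c \<longleftrightarrow>
     c \<in> \<A> \<and> (\<exists>K. compactin X K \<and> fst c = topspace X - K) \<and>
     chart_image c = - cball 0 1 \<and>
     (\<exists>s>1/2. \<forall>i j. big_O_deriv 2 s (\<lambda>x. G c x $ i $ j - of_bool (i = j)))"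


section \<open>Energy and center of mass\<close>

definition sphere_param :: "real \<Rightarrow> real \<Rightarrow> real \<Rightarrow> real^3" where
  "sphere_param \<rho> \<theta> \<phi> = \<rho> *\<^sub>R vector [sin \<theta> * cos \<phi>, sin \<theta> * sin \<phi>, cos \<theta>]"

text \<open>The surface integral over the sphere of radius \<open>\<rho>\<close> about the origin, in spherical
  coordinates with area element \<open>\<rho>\<^sup>2 sin \<theta> d\<theta> d\<phi>\<close>.\<close>

definition sphere_integral :: "real \<Rightarrow> (real^3 \<Rightarrow> real) \<Rightarrow> real" where
  "sphere_integral \<rho> f =
     integral (cbox (0, 0) (pi, 2 * pi)) (\<lambda>(\<theta>, \<phi>). f (sphere_param \<rho> \<theta> \<phi>) * (\<rho>\<^sup>2 * sin \<theta>))"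

definition mass_density :: "metric_coeffs \<Rightarrow> real^3 \<Rightarrow> real" where
  "mass_density g x =
     (\<Sum>i\<in>UNIV. \<Sum>j\<in>UNIV. (dmet g i i j x - dmet g j i i x) * (x $ j / norm x))"

definition has_energy :: "metric_coeffs \<Rightarrow> real \<Rightarrow> bool" where
  "has_energy g E \<longleftrightarrow> ((\<lambda>\<rho>. 1 / (16 * pi) * sphere_integral \<rho> (mass_density g)) \<longlongrightarrow> E) at_top"

text \<open>The \<open>l\<close>-th component of the center of mass is the limit, as \<open>\<rho>\<close> tends to infinity, of
  \<open>center_integral g l \<rho>\<close> divided by \<open>16 \<pi> E\<close>, where \<open>E\<close> is the energy.\<close>

definition center_integral :: "metric_coeffs \<Rightarrow> 3 \<Rightarrow> real \<Rightarrow> real" where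
  "center_integral g l \<rho> =
     sphere_integral \<rho> (\<lambda>x. x $ l * mass_density g x
        - (\<Sum>i\<in>UNIV. g x $ i $ l * (x $ i / norm x) - g x $ i $ i * (x $ l / norm x)))"

end

theory Submission
  imports Defs "HOL-Library.Landau_Symbols"
begin

text \<open>The integrand of the center of mass is the flux of a vector field whose divergence is \<open>x\<^sub>1\<close>
  times the linearized scalar curvature \<open>L g\<close>, so the derivative of the flux integral in \<open>\<rho>\<close> is the
  integral of \<open>x\<^sub>1 L g\<close> over the sphere of radius \<open>\<rho>\<close>. Vanishing of the scalar curvature turns \<open>L g\<close>
  into minus the quadratic part of the curvature, which up to \<open>O(r\<^sup>-\<^sup>4\<^sup>-\<^sup>q)\<close> is that of the model
  perturbation \<open>A r\<^sup>-\<^sup>1 \<delta> + h\<close>. With \<open>n = x / r\<close> it equals \<open>r\<^sup>-\<^sup>4\<close> times an even function of \<open>n\<close>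
  plus \<open>3/2 A n\<^sub>1\<close>, so the derivative is \<open>-2 \<pi> A / \<rho> + O(\<rho>\<^sup>-\<^sup>1\<^sup>-\<^sup>q)\<close>. The energy is \<open>A / 2\<close>, hence
  \<open>A\<close> is nonzero and the integrals diverge logarithmically.\<close>

text \<open>The expansion cannot simply be inserted into the center integral: its error is
  O(r^(-1-q)) in the integrand, which over a sphere of area 4 pi \<rho>^2 leaves O(\<rho>^(1-q)).
  Differentiating in \<rho> alone is no cure: the linearized curvature is known only up to
  O(r^(-3-q)), which contributes O(\<rho>^(-q)) to the derivative, and integrating this still swamps
  a logarithm. Vanishing scalar curvature gains the missing power, because in quadratic terms the
  remainder is always multiplied by a second small factor; the error in the derivative becomes
  integrable.

  The logarithm has a geometric origin. With X = (log r e_1 - n_1 n) / 4 one has h_ij = d_i X_j +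
  d_j X_i, so to first order h is a coordinate change that moves the sphere of radius r, up to
  bounded terms, by (log r) / 4 along the first axis. Hence h has no linearized curvature of its own
  and acts on the center only through its product with A. Dividing -2 pi A log \<rho> by 16 pi E = 8
  pi A gives -(log \<rho>) / 4, the coefficient found in X.\<close>

section \<open>The quadratic part of the scalar curvature of the model metric\<close>

text \<open>By homogeneity, \<open>jet0\<close>, \<open>jet1\<close> and \<open>jet2\<close> at a unit vector \<open>n\<close> determine the
  components of the model perturbation \<open>A r\<^sup>-\<^sup>1 \<delta>\<^sub>i\<^sub>j + h\<^sub>i\<^sub>j\<close> and of its first and second
  partial derivatives, up to the factors \<open>r\<^sup>-\<^sup>1\<close>, \<open>r\<^sup>-\<^sup>2\<close> and \<open>r\<^sup>-\<^sup>3\<close>. Derivative indices come first.\<close>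

definition jet0 :: "real \<Rightarrow> real^3 \<Rightarrow> 3 \<Rightarrow> 3 \<Rightarrow> real" where
  "jet0 A n i j = (A - n$1/2) * of_bool (i = j) + n$1 * n$i * n$j"

definition jet1 :: "real \<Rightarrow> real^3 \<Rightarrow> 3 \<Rightarrow> 3 \<Rightarrow> 3 \<Rightarrow> real" where
  "jet1 A n k i j =
     (n$1 * n$k - A * n$k - of_bool (k = 1)/2) * of_bool (i = j)
     + (of_bool (k = 1) - 4 * n$1 * n$k) * n$i * n$j
     + n$1 * (of_bool (i = k) * n$j + n$i * of_bool (j = k))"

definition jet2 :: "real \<Rightarrow> real^3 \<Rightarrow> 3 \<Rightarrow> 3 \<Rightarrow> 3 \<Rightarrow> 3 \<Rightarrow> real" where
  "jet2 A n l k i j =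
     of_bool (i = j) * (A * (3 * n$k * n$l - of_bool (k = l)) + of_bool (k = 1) * n$l
        + of_bool (l = 1) * n$k + n$1 * of_bool (k = l) - 4 * n$1 * n$k * n$l)
     + of_bool (k = 1) * (of_bool (i = l) * n$j + n$i * of_bool (j = l))
     + of_bool (l = 1) * (of_bool (i = k) * n$j + n$i * of_bool (j = k))
     + n$1 * (of_bool (i = k) * of_bool (j = l) + of_bool (i = l) * of_bool (j = k))
     - 4 * n$l * (of_bool (k = 1) * n$i * n$j + n$1 * of_bool (i = k) * n$j + n$1 * n$i * of_bool (j = k))
     - 4 * (of_bool (l = 1) * n$i * n$j * n$k + n$1 * of_bool (i = l) * n$j * n$k
          + n$1 * n$i * of_bool (j = l) * n$k + n$1 * n$i * n$j * of_bool (k = l))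
     + 24 * n$1 * n$i * n$j * n$k * n$l"

text \<open>\<open>ric_lin\<close> is the linear part of the Ricci tensor at the flat metric, and \<open>ric_quad\<close> and
  \<open>scal_quad\<close> are the quadratic parts of Ricci and scalar curvature, as functions of the
  perturbation \<open>h\<close> and its derivatives. In \<open>dgam_quad\<close> the inverse metric is
  \<open>\<delta> - h\<close> to first order.\<close>

definition low :: "(3 \<Rightarrow> 3 \<Rightarrow> 3 \<Rightarrow> real) \<Rightarrow> 3 \<Rightarrow> 3 \<Rightarrow> 3 \<Rightarrow> real" where
  "low d i j l = d i j l + d j i l - d l i j"

definition ric_lin :: "(3 \<Rightarrow> 3 \<Rightarrow> 3 \<Rightarrow> 3 \<Rightarrow> real) \<Rightarrow> 3 \<Rightarrow> 3 \<Rightarrow> real" where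
  "ric_lin dd i j = (\<Sum>k\<in>UNIV. low (dd k) i j k - low (dd j) i k k) / 2"

definition dgam_quad :: "(3 \<Rightarrow> 3 \<Rightarrow> real) \<Rightarrow> (3 \<Rightarrow> 3 \<Rightarrow> 3 \<Rightarrow> real) \<Rightarrow> (3 \<Rightarrow> 3 \<Rightarrow> 3 \<Rightarrow> 3 \<Rightarrow> real) \<Rightarrow>
    3 \<Rightarrow> 3 \<Rightarrow> 3 \<Rightarrow> 3 \<Rightarrow> real" where
  "dgam_quad h d dd m k i j = - (\<Sum>l\<in>UNIV. d m k l * low d i j l + h k l * low (dd m) i j l) / 2"

definition ric_quad :: "(3 \<Rightarrow> 3 \<Rightarrow> real) \<Rightarrow> (3 \<Rightarrow> 3 \<Rightarrow> 3 \<Rightarrow> real) \<Rightarrow> (3 \<Rightarrow> 3 \<Rightarrow> 3 \<Rightarrow> 3 \<Rightarrow> real) \<Rightarrow>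
    3 \<Rightarrow> 3 \<Rightarrow> real" where
  "ric_quad h d dd i j = (\<Sum>k\<in>UNIV. dgam_quad h d dd k k i j - dgam_quad h d dd j k i k
     + (\<Sum>l\<in>UNIV. low d k l k * low d i j l - low d j l k * low d i k l) / 4)"

definition scal_quad :: "(3 \<Rightarrow> 3 \<Rightarrow> real) \<Rightarrow> (3 \<Rightarrow> 3 \<Rightarrow> 3 \<Rightarrow> real) \<Rightarrow> (3 \<Rightarrow> 3 \<Rightarrow> 3 \<Rightarrow> 3 \<Rightarrow> real) \<Rightarrow>
    real" where
  "scal_quad h d dd = (\<Sum>i\<in>UNIV. ric_quad h d dd i i)
     - (\<Sum>i\<in>UNIV. \<Sum>j\<in>UNIV. h i j * ric_lin dd i j)"

lemma norm_one_3:
  fixes n :: "real^3"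
  assumes "norm n = 1"
  shows "n$3 * n$3 = 1 - n$1 * n$1 - n$2 * n$2"
  using assms by (simp add: norm_vec_def L2_set_def sum_3 power2_eq_square)

text \<open>Orients the equation of the unit sphere as a rewrite rule that removes squares of
  \<open>n$3\<close>. The second form catches right-nested products, so that \<open>simp\<close>
  compares polynomials in \<open>n\<close> modulo this equation.\<close>

lemma norm_one_reduce:
  fixes n :: "real^3"
  assumes "norm n = 1"
  shows "n$3 * n$3 = 1 - n$1 * n$1 - n$2 * n$2"
    "n$3 * (n$3 * z) = (1 - n$1 * n$1 - n$2 * n$2) * z"
  using norm_one_3[OF assms] by (simp_all flip: mult.assoc)

text \<open>The perturbation h drops out, being an infinitesimal coordinate change of the flat
  metric. What remains comes from the conformal part A / r: since 1 / r is harmonic, its linearized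
  Ricci tensor is minus half the Hessian of A / r.\<close>

lemma ric_lin_jet2:
  assumes "norm n = 1"
  shows "ric_lin (jet2 A n) i j = A / 2 * (of_bool (i = j) - 3 * n$i * n$j)"
proof -
  note r = norm_one_reduce[OF assms]
  have "\<forall>i j. ric_lin (jet2 A n) i j = A / 2 * (of_bool (i = j) - 3 * n$i * n$j)"
    unfolding forall_3 ric_lin_def low_def jet2_def sum_3
    by (simp add: r field_simps)
  then show ?thesis by blast
qed

text \<open>This contraction is the coefficient of the undifferentiated perturbation in the trace of
  \<open>ric_quad\<close>. By the symmetries of second derivatives it is again twice the linearized
  Ricci tensor.\<close>

lemma low_trace_jet2:
  assumes "norm n = 1"
  shows "(\<Sum>i\<in>UNIV. low (jet2 A n k) i i l - low (jet2 A n i) i k l)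
    = A * (of_bool (k = l) - 3 * n$k * n$l)"
proof -
  note r = norm_one_reduce[OF assms]
  have "\<forall>k l. (\<Sum>i\<in>UNIV. low (jet2 A n k) i i l - low (jet2 A n i) i k l)
    = A * (of_bool (k = l) - 3 * n$k * n$l)"
    unfolding forall_3 low_def jet2_def sum_3
    by (simp add: r field_simps)
  then show ?thesis by blast
qed

text \<open>\<open>low d\<close> is twice the Christoffel symbol of the first kind. Once the
  products of first derivatives are sorted into the divergence \<open>T\<close>, the trace
  \<open>t\<close> and two full contractions, each piece is a short polynomial on the jets; this
  keeps the expansion in \<open>scal_quad_jet\<close> manageable.\<close>

lemma quad_first_order:
  fixes d :: "3 \<Rightarrow> 3 \<Rightarrow> 3 \<Rightarrow> real"
  assumes "\<And>k i j. d k i j = d k j i"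
  defines "T \<equiv> \<lambda>j. \<Sum>i\<in>UNIV. d i i j" and "t \<equiv> \<lambda>k. \<Sum>i\<in>UNIV. d k i i"
  shows "(\<Sum>i\<in>UNIV. \<Sum>k\<in>UNIV. - (\<Sum>l\<in>UNIV. d k k l * low d i i l) / 2
        + (\<Sum>l\<in>UNIV. d i k l * low d i k l) / 2
        + (\<Sum>l\<in>UNIV. low d k l k * low d i i l - low d i l k * low d i k l) / 4)
    = (\<Sum>l\<in>UNIV. T l * t l - T l * T l - t l * t l / 4)
      + (\<Sum>i\<in>UNIV. \<Sum>k\<in>UNIV. \<Sum>l\<in>UNIV. 3/4 * d l i k * d l i k - d l i k * d k i l / 2)"
proof -
  have s: "d k 2 1 = d k 1 2" "d k 3 1 = d k 1 3" "d k 3 2 = d k 2 3" for k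
    using assms(1) by blast+
  show ?thesis
    unfolding low_def T_def t_def sum_3 s
    by (simp add: field_simps)
qed

lemma divergence_jet1:
  assumes "norm n = 1"
  shows "(\<Sum>i\<in>UNIV. jet1 A n i i j) = 2 * n$1 * n$j - A * n$j - of_bool (j = 1) / 2"
proof -
  note r = norm_one_reduce[OF assms]
  have "\<forall>j. (\<Sum>i\<in>UNIV. jet1 A n i i j) = 2 * n$1 * n$j - A * n$j - of_bool (j = 1) / 2"
    unfolding forall_3 jet1_def sum_3
    by (simp add: r field_simps)
  then show ?thesis by blast
qed

lemma trace_jet1:
  assumes "norm n = 1"
  shows "(\<Sum>i\<in>UNIV. jet1 A n k i i) = n$1 * n$k - 3 * A * n$k - of_bool (k = 1) / 2"
proof -
  note r = norm_one_reduce[OF assms]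
  have "\<forall>k. (\<Sum>i\<in>UNIV. jet1 A n k i i) = n$1 * n$k - 3 * A * n$k - of_bool (k = 1) / 2"
    unfolding forall_3 jet1_def sum_3
    by (simp add: r field_simps)
  then show ?thesis by blast
qed

lemma squares_jet1:
  assumes "norm n = 1"
  shows "(\<Sum>i\<in>UNIV. \<Sum>k\<in>UNIV. \<Sum>l\<in>UNIV.
      3/4 * jet1 A n l i k * jet1 A n l i k - jet1 A n l i k * jet1 A n k i l / 2)
    = 7/4 * A\<^sup>2 + 7/16 + 3/4 * A * n$1 + n$1 * n$1"
proof -
  note r = norm_one_reduce[OF assms]
  show ?thesis
    unfolding jet1_def sum_3 power2_eq_square
    by (simp add: r field_simps)
qed

text \<open>The term \<open>3/2 * A * n$1\<close>, the interaction of the mass with \<open>h\<close>, is the only odd one,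
  and it causes the logarithmic divergence.\<close>

lemma scal_quad_jet:
  assumes "norm n = 1"
  shows "scal_quad (jet0 A n) (jet1 A n) (jet2 A n)
    = 3/2 * A\<^sup>2 + 3/8 + 3/2 * A * n$1 - n$1 * n$1 / 2"
proof -
  note r = norm_one_reduce[OF assms]
  let ?h = "jet0 A n" and ?d = "jet1 A n" and ?dd = "jet2 A n"
  define Z where "Z = (\<lambda>k l. A * (of_bool (k = l) - 3 * n$k * n$l))"
  have sym: "?d k i j = ?d k j i" for k i j
    by (simp add: jet1_def algebra_simps)
  have "(\<Sum>i\<in>UNIV. ric_quad ?h ?d ?dd i i) =
      (\<Sum>i\<in>UNIV. \<Sum>k\<in>UNIV. - (\<Sum>l\<in>UNIV. ?d k k l * low ?d i i l) / 2
        + (\<Sum>l\<in>UNIV. ?d i k l * low ?d i k l) / 2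
        + (\<Sum>l\<in>UNIV. low ?d k l k * low ?d i i l - low ?d i l k * low ?d i k l) / 4)
      - (\<Sum>k\<in>UNIV. \<Sum>l\<in>UNIV. ?h k l * (\<Sum>i\<in>UNIV. low (?dd k) i i l - low (?dd i) i k l)) / 2"
    unfolding ric_quad_def dgam_quad_def sum_3
    by (simp add: field_simps)
  also have "\<dots> = (\<Sum>l\<in>UNIV. (2 * n$1 * n$l - A * n$l - of_bool (l = 1) / 2) * (n$1 * n$l - 3 * A * n$l - of_bool (l = 1) / 2)
        - (2 * n$1 * n$l - A * n$l - of_bool (l = 1) / 2) * (2 * n$1 * n$l - A * n$l - of_bool (l = 1) / 2)
        - (n$1 * n$l - 3 * A * n$l - of_bool (l = 1) / 2) * (n$1 * n$l - 3 * A * n$l - of_bool (l = 1) / 2) / 4)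
      + (7/4 * A\<^sup>2 + 7/16 + 3/4 * A * n$1 + n$1 * n$1)
      - (\<Sum>k\<in>UNIV. \<Sum>l\<in>UNIV. ?h k l * Z k l) / 2"
    unfolding quad_first_order[of ?d, OF sym] divergence_jet1[OF assms] trace_jet1[OF assms]
      squares_jet1[OF assms] low_trace_jet2[OF assms] Z_def by simp
  finally have 1: "(\<Sum>i\<in>UNIV. ric_quad ?h ?d ?dd i i) = \<dots>" .
  \<comment> \<open>Tracing with the inverse metric \<delta> - h instead of \<delta> reproduces the
    contraction with \<open>Z\<close> already present in the trace of \<open>ric_quad\<close>, so
    its contribution doubles.\<close>
  have 2: "(\<Sum>i\<in>UNIV. \<Sum>j\<in>UNIV. ?h i j * ric_lin ?dd i j) = (\<Sum>k\<in>UNIV. \<Sum>l\<in>UNIV. ?h k l * Z k l) / 2"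
    unfolding ric_lin_jet2[OF assms] Z_def sum_divide_distrib
    by (intro sum.cong refl) (simp add: field_simps)
  \<comment> \<open>\<open>Z\<close> is trace-free, so the \<delta> part of \<open>?h\<close>
    contributes nothing; only n_1 n_k n_l is left, against which \<open>Z\<close> gives A n_1 (1 -
    3).\<close>
  have 3: "(\<Sum>k\<in>UNIV. \<Sum>l\<in>UNIV. ?h k l * Z k l) = - 2 * A * n$1"
    unfolding Z_def jet0_def sum_3 by (simp add: r field_simps)
  show ?thesis
    unfolding scal_quad_def 1 2 3
    by (simp add: sum_3 r field_simps power2_eq_square)
qed

section \<open>Partial derivatives and decay at infinity\<close>

text \<open>\<open>partial_deriv\<close> has an unspecified value where the derivative does not
  exist. The relational form carries existence along, so that sum and product rules compose without
  side conditions.\<close>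

definition has_partial :: "(real^3 \<Rightarrow> real) \<Rightarrow> 3 \<Rightarrow> real \<Rightarrow> real^3 \<Rightarrow> bool" where
  "has_partial f i D x \<longleftrightarrow> ((\<lambda>t. f (x + t *\<^sub>R axis i 1)) has_field_derivative D) (at 0)"

lemma has_partial_imp_partial_deriv: "has_partial f i D x \<Longrightarrow> partial_deriv i f x = D"
  unfolding has_partial_def partial_deriv_def by (rule DERIV_imp_deriv)

lemma has_derivative_imp_has_partial:
  assumes "(f has_derivative f') (at x)"
  shows "has_partial f i (f' (axis i 1)) x"
proof -
  have "((\<lambda>t::real. x + t *\<^sub>R axis i 1) has_derivative (\<lambda>t. t *\<^sub>R axis i 1)) (at 0)"
    by (auto intro!: derivative_eq_intros)
  then have "((\<lambda>t::real. f (x + t *\<^sub>R axis i 1)) has_derivative (\<lambda>t. f' (t *\<^sub>R axis i 1))) (at 0)"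
    by (rule has_derivative_compose) (use assms in simp)
  moreover have "(\<lambda>t. f' (t *\<^sub>R axis i 1)) = (*) (f' (axis i 1))"
    using has_derivative_linear[OF assms] by (simp add: linear_cmul fun_eq_iff)
  ultimately show ?thesis
    unfolding has_partial_def has_field_derivative_def by simp
qed

lemma differentiable_imp_has_partial:
  "f differentiable (at x) \<Longrightarrow> has_partial f i (partial_deriv i f x) x"
  by (metis differentiable_def has_derivative_imp_has_partial has_partial_imp_partial_deriv)

lemma differentiable_gradient:
  assumes "f differentiable (at x)"
  shows "(f has_derivative (\<lambda>v. \<Sum>i\<in>UNIV. v$i * partial_deriv i f x)) (at x)"
proof -
  obtain f' where f': "(f has_derivative f') (at x)"
    using assms by (auto simp: differentiable_def)
  have lin: "linear f'"
    using f' has_derivative_linear by blast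
  have "f' v = (\<Sum>i\<in>UNIV. v$i * partial_deriv i f x)" for v
  proof -
    have "f' v = f' (\<Sum>i\<in>UNIV. v$i *\<^sub>R axis i 1)"
      using basis_expansion[of v] by (simp add: scalar_mult_eq_scaleR)
    also have "\<dots> = (\<Sum>i\<in>UNIV. v$i * f' (axis i 1))"
      using lin by (simp add: linear_sum linear_cmul)
    finally show ?thesis
      using has_partial_imp_partial_deriv[OF has_derivative_imp_has_partial[OF f']] by simp
  qed
  then have "f' = (\<lambda>v. \<Sum>i\<in>UNIV. v$i * partial_deriv i f x)" ..
  then show ?thesis using f' by simp
qed

lemma has_partial_const: "has_partial (\<lambda>x. a) i 0 x"
  by (simp add: has_partial_def)

lemma has_partial_component: "has_partial (\<lambda>x. x $ j) i (of_bool (j = i)) x"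
  unfolding has_partial_def by (auto intro!: derivative_eq_intros simp: axis_def)

lemma has_partial_add:
  "has_partial f i D x \<Longrightarrow> has_partial g i D' x \<Longrightarrow> has_partial (\<lambda>x. f x + g x) i (D + D') x"
  unfolding has_partial_def by (rule DERIV_add)

lemma has_partial_diff:
  "has_partial f i D x \<Longrightarrow> has_partial g i D' x \<Longrightarrow> has_partial (\<lambda>x. f x - g x) i (D - D') x"
  unfolding has_partial_def by (rule DERIV_diff)

lemma has_partial_mult:
  "has_partial f i D x \<Longrightarrow> has_partial g i D' x \<Longrightarrow>
    has_partial (\<lambda>x. f x * g x) i (D * g x + f x * D') x"
  unfolding has_partial_def by (auto intro!: derivative_eq_intros)

lemma has_partial_cmult:
  "has_partial f i D x \<Longrightarrow> has_partial (\<lambda>x. a * f x) i (a * D) x"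
  unfolding has_partial_def by (auto intro!: derivative_eq_intros)

lemma has_partial_sum:
  "(\<And>a. a \<in> I \<Longrightarrow> has_partial (f a) i (D a) x) \<Longrightarrow>
    has_partial (\<lambda>x. \<Sum>a\<in>I. f a x) i (\<Sum>a\<in>I. D a) x"
  unfolding has_partial_def by (rule DERIV_sum)

lemma has_partial_transform:
  assumes "has_partial f i D x" "open S" "x \<in> S" "\<And>y. y \<in> S \<Longrightarrow> f y = g y"
  shows "has_partial g i D x"
proof -
  have "continuous_on UNIV (\<lambda>t::real. x + t *\<^sub>R axis i 1)"
    by (intro continuous_intros)
  then have "open ((\<lambda>t::real. x + t *\<^sub>R axis i 1) -` S)"
    using assms(2) continuous_on_open_vimage[OF open_UNIV] by auto
  then show ?thesis
    using assms unfolding has_partial_def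
    by (elim has_field_derivative_transform_within_open) auto
qed

lemma has_partial_inverse_norm:
  assumes "x \<noteq> 0"
  shows "has_partial (\<lambda>x. inverse (norm x)) k
    (- (x /\<^sub>R norm x)$k * (inverse (norm x))\<^sup>2) x"
proof -
  have "((\<lambda>x. inverse (norm x)) has_derivative
      (\<lambda>h. - (inverse (norm x) * (h \<bullet> sgn x) * inverse (norm x)))) (at x)"
    using assms has_derivative_norm[OF assms] by (auto intro!: derivative_eq_intros)
  from has_derivative_imp_has_partial[OF this, of k] show ?thesis
    by (simp add: inner_axis sgn_div_norm power2_eq_square inner_commute[of "axis k 1"] algebra_simps)
qed

lemma has_partial_direction:
  assumes "x \<noteq> 0"
  shows "has_partial (\<lambda>x. (x /\<^sub>R norm x)$i) k
    ((of_bool (i = k) - (x /\<^sub>R norm x)$i * (x /\<^sub>R norm x)$k) * inverse (norm x)) x"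
proof -
  have "has_partial (\<lambda>x. inverse (norm x) * x$i) k
     (- (x /\<^sub>R norm x)$k * (inverse (norm x))\<^sup>2 * x$i + inverse (norm x) * of_bool (i = k)) x"
    by (intro has_partial_mult has_partial_inverse_norm assms has_partial_component)
  then show ?thesis
    by (simp add: algebra_simps power2_eq_square)
qed

section \<open>Derivatives of the model perturbation\<close>

context
  fixes m :: "real \<Rightarrow> real^3" and s :: "real \<Rightarrow> real" and k :: 3
  assumes m: "\<And>i. ((\<lambda>t. m t $ i) has_field_derivative (of_bool (i = k) - m 0 $ i * m 0 $ k) * s 0) (at 0)"
    and s: "(s has_field_derivative - m 0 $ k * (s 0)\<^sup>2) (at 0)"
begin

text \<open>In this context \<open>m\<close> and \<open>s\<close> stand for x / r and 1 / r along
  the line x + t e_k. Only their derivatives at 0 are assumed, so the differentiation rules treat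
  them as atoms and polynomial algebra remains.\<close>

lemma jet0_deriv:
  "((\<lambda>t. jet0 A (m t) i j * s t) has_field_derivative jet1 A (m 0) k i j * (s 0)\<^sup>2) (at 0)"
  unfolding jet0_def
  by (rule DERIV_cong, (rule m s DERIV_cdivide DERIV_const DERIV_add DERIV_diff DERIV_mult DERIV_power)+)
    (simp add: jet1_def field_simps power2_eq_square)

lemma jet1_deriv:
  "((\<lambda>t. jet1 A (m t) l i j * (s t)\<^sup>2) has_field_derivative jet2 A (m 0) k l i j * (s 0)^3) (at 0)"
  unfolding jet1_def
  by (rule DERIV_cong, (rule m s DERIV_cdivide DERIV_const DERIV_add DERIV_diff DERIV_mult DERIV_power)+)
    (simp add: jet2_def algebra_simps power2_eq_square power3_eq_cube)

end

lemma has_partial_jet0: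
  assumes "x \<noteq> 0"
  shows "has_partial (\<lambda>x. jet0 A (x /\<^sub>R norm x) i j * inverse (norm x)) k
    (jet1 A (x /\<^sub>R norm x) k i j * (inverse (norm x))\<^sup>2) x"
  using jet0_deriv[of "\<lambda>t. (x + t *\<^sub>R axis k 1) /\<^sub>R norm (x + t *\<^sub>R axis k 1)" k
      "\<lambda>t. inverse (norm (x + t *\<^sub>R axis k 1))" A i j]
    has_partial_direction[OF assms, of _ k] has_partial_inverse_norm[OF assms, of k]
  by (simp add: has_partial_def)

lemma has_partial_jet1:
  assumes "x \<noteq> 0"
  shows "has_partial (\<lambda>x. jet1 A (x /\<^sub>R norm x) l i j * (inverse (norm x))\<^sup>2) k
    (jet2 A (x /\<^sub>R norm x) k l i j * (inverse (norm x))^3) x"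
  using jet1_deriv[of "\<lambda>t. (x + t *\<^sub>R axis k 1) /\<^sub>R norm (x + t *\<^sub>R axis k 1)" k
      "\<lambda>t. inverse (norm (x + t *\<^sub>R axis k 1))" A l i j]
    has_partial_direction[OF assms, of _ k] has_partial_inverse_norm[OF assms, of k]
  by (simp add: has_partial_def)

section \<open>Rates of decay at infinity\<close>

abbreviation decays :: "real \<Rightarrow> (real^3 \<Rightarrow> real) \<Rightarrow> bool" where
  "decays p f \<equiv> f \<in> O[at_infinity](\<lambda>x. norm x powr (- p))"

lemma decays_mult:
  assumes "decays p f" "decays p' g"
  shows "decays (p + p') (\<lambda>x. f x * g x)"
proof -
  have "(\<lambda>x. f x * g x) \<in> O[at_infinity](\<lambda>x::real^3. norm x powr (-p) * norm x powr (-p'))"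
    using assms by (rule landau_o.big.mult)
  moreover have "norm x powr (-p) * norm x powr (-p') = norm x powr (-(p + p'))" for x :: "real^3"
    by (simp flip: powr_add)
  ultimately show ?thesis by simp
qed

lemma decays_mono:
  assumes "decays p f" "p' \<le> p"
  shows "decays p' f"
proof -
  have "(\<lambda>x::real^3. norm x powr (-p)) \<in> O[at_infinity](\<lambda>x. norm x powr (-p'))"
  proof (rule bigoI[of _ 1])
    show "\<forall>\<^sub>F x::real^3 in at_infinity. norm (norm x powr (-p)) \<le> 1 * norm (norm x powr (-p'))"
      unfolding eventually_at_infinity
      by (rule exI[of _ 1]) (use assms(2) in \<open>auto intro!: powr_mono\<close>)
  qed
  with assms(1) show ?thesis by (rule landau_o.big_trans)
qed

lemma decays_sum: "(\<And>i. i \<in> I \<Longrightarrow> decays p (f i)) \<Longrightarrow> decays p (\<lambda>x. \<Sum>i\<in>I. f i x)"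
  by (rule big_sum_in_bigo)

text \<open>The angular factor of a function homogeneous of degree -k is bounded because the unit
  sphere is compact.\<close>

lemma decays_homogeneous:
  assumes "continuous_on (sphere 0 1) f"
  shows "decays (real k) (\<lambda>x. f (x /\<^sub>R norm x) * inverse (norm x) ^ k)"
proof -
  have "compact (f ` sphere 0 1)"
    using assms by (intro compact_continuous_image) auto
  then obtain B where B: "\<And>n. norm n = 1 \<Longrightarrow> \<bar>f n\<bar> \<le> B"
    using compact_imp_bounded[of "f ` sphere 0 1"] unfolding bounded_iff by fastforce
  show ?thesis
  proof (rule bigoI[of _ B])
    show "\<forall>\<^sub>F x in at_infinity. norm (f (x /\<^sub>R norm x) * inverse (norm x) ^ k) \<le> B * norm (norm x powr - real k)"
      unfolding eventually_at_infinity
    proof (rule exI[of _ 1], intro allI impI)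
      fix x :: "real^3" assume "1 \<le> norm x"
      then have "0 < norm x" by linarith
      then have "norm x powr - real k = inverse (norm x) ^ k"
        by (simp add: powr_minus powr_realpow power_inverse)
      moreover have "\<bar>f (x /\<^sub>R norm x)\<bar> \<le> B"
        using \<open>0 < norm x\<close> by (intro B) simp
      ultimately show "norm (f (x /\<^sub>R norm x) * inverse (norm x) ^ k) \<le> B * norm (norm x powr - real k)"
        by (auto simp: abs_mult intro!: mult_right_mono)
    qed
  qed
qed

lemma decays_iff:
  "decays p f \<longleftrightarrow> (\<exists>C r0. \<forall>x. norm x > r0 \<longrightarrow> \<bar>f x\<bar> \<le> C * norm x powr (- p))"
proof
  assume "decays p f"
  then obtain C where "\<forall>\<^sub>F x in at_infinity. norm (f x) \<le> C * norm (norm x powr (- p))"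
    by (elim landau_o.bigE)
  then show "\<exists>C r0. \<forall>x. norm x > r0 \<longrightarrow> \<bar>f x\<bar> \<le> C * norm x powr (- p)"
    by (fastforce simp: eventually_at_infinity intro: less_imp_le)
next
  assume "\<exists>C r0. \<forall>x. norm x > r0 \<longrightarrow> \<bar>f x\<bar> \<le> C * norm x powr (- p)"
  then obtain C r0 where C: "\<And>x. norm x > r0 \<Longrightarrow> \<bar>f x\<bar> \<le> C * norm x powr (- p)"
    by blast
  show "decays p f"
    by (rule bigoI[of _ C])
      (use C in \<open>auto simp: eventually_at_infinity intro!: exI[of _ "r0 + 1"]\<close>)
qed

lemma big_O_deriv_imp_decays:
  assumes "big_O_deriv k p f" "length is \<le> k"
  shows "decays (p + real (length is)) (iter_partial_deriv is f)"
  using assms unfolding big_O_deriv_def decays_iff by fastforce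

lemma decays_transform:
  assumes "decays p f" "\<And>x. norm x > r0 \<Longrightarrow> f x = f' x"
  shows "decays p f'"
proof -
  have "\<forall>\<^sub>F x in at_infinity. f x = f' x"
    unfolding eventually_at_infinity
    by (rule exI[of _ "r0 + 1"]) (use assms(2) in auto)
  then show ?thesis using assms(1) landau_o.big.in_cong by blast
qed

lemma continuous_on_jet:
  "continuous_on S (\<lambda>n. jet0 A n i j)" "continuous_on S (\<lambda>n. jet1 A n k i j)"
  "continuous_on S (\<lambda>n. jet2 A n l k i j)"
  unfolding jet0_def jet1_def jet2_def by (intro continuous_intros; simp)+

section \<open>Inverse matrices\<close>

lemma matrix_inv_inverse:
  fixes M :: "real^'n^'n"
  assumes "invertible M"
  shows "M ** matrix_inv M = mat 1" "matrix_inv M ** M = mat 1"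
  using assms someI_ex[of "\<lambda>M'. M ** M' = mat 1 \<and> M' ** M = mat 1"]
  unfolding invertible_def matrix_inv_def by auto

lemma matrix_inv_entries:
  fixes M :: "real^'n^'n"
  assumes "invertible M"
  shows "(\<Sum>a\<in>UNIV. M$k$a * matrix_inv M$a$l) = of_bool (k = l)"
    "(\<Sum>a\<in>UNIV. matrix_inv M$k$a * M$a$l) = of_bool (k = l)"
  using matrix_inv_inverse[OF assms]
  by (auto simp: matrix_matrix_mult_def mat_def vec_eq_iff)

text \<open>Exhibits the entries of the inverse as quotients of polynomials in the entries of the
  matrix; this is how their differentiability is obtained.\<close>

lemma matrix_inv_cramer:
  fixes M :: "real^'n^'n"
  assumes "invertible M"
  shows "matrix_inv M $ k $ l = det (\<chi> a b. if b = k then axis l 1 $ a else M$a$b) / det M"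
proof -
  have "M *v (\<chi> a. matrix_inv M $ a $ l) = axis l 1"
    using matrix_inv_entries[OF assms]
    by (auto simp: matrix_vector_mult_def vec_eq_iff axis_def)
  then have "(\<chi> a. matrix_inv M $ a $ l)
      = (\<chi> k. det (\<chi> a b. if b = k then axis l 1 $ a else M$a$b) / det M)"
    using cramer[of M] assms by (simp add: invertible_det_nz)
  then show ?thesis by (simp add: vec_eq_iff)
qed

lemma positive_definite_imp_invertible:
  fixes M :: "real^'n^'n"
  assumes "\<And>v. v \<noteq> 0 \<Longrightarrow> v \<bullet> (M *v v) > 0"
  shows "invertible M"
proof -
  have "\<forall>v. M *v v = 0 \<longrightarrow> v = 0"
    using assms by fastforce
  then show ?thesis
    by (simp add: invertible_left_inverse matrix_left_invertible_ker)
qed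

lemma det_3_differentiable:
  fixes N :: "real \<Rightarrow> real^3^3"
  assumes "\<And>a b. (\<lambda>t. N t $ a $ b) field_differentiable (at x)"
  shows "(\<lambda>t. det (N t)) field_differentiable (at x)"
  unfolding det_3
  by (intro field_differentiable_add field_differentiable_diff field_differentiable_mult assms)

text \<open>Cramer's rule supplies the existence of the derivative. Its value then follows from the
  product rule for M M^(-1) = 1, without differentiating determinants.\<close>

lemma matrix_inv_has_derivative:
  fixes M :: "real \<Rightarrow> real^3^3" and D :: "3 \<Rightarrow> 3 \<Rightarrow> real"
  assumes D: "\<And>i j. ((\<lambda>t. M t $ i $ j) has_field_derivative D i j) (at x)"
    and U: "open U" "x \<in> U" "\<And>t. t \<in> U \<Longrightarrow> invertible (M t)"
  defines "P \<equiv> matrix_inv (M x)"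
  shows "((\<lambda>t. matrix_inv (M t) $ k $ l) has_field_derivative
    - (\<Sum>a\<in>UNIV. \<Sum>b\<in>UNIV. P $ k $ a * D a b * P $ b $ l)) (at x)"
proof -
  have diff: "(\<lambda>t. matrix_inv (M t) $ k $ l) field_differentiable (at x)" for k l
  proof -
    have "(\<lambda>t. det (\<chi> a b. if b = k then axis l 1 $ a else M t$a$b) / det (M t))
        field_differentiable (at x)"
    proof (intro field_differentiable_divide det_3_differentiable)
      fix a b
      show "(\<lambda>t. (\<chi> a b. if b = k then axis l 1 $ a else M t$a$b) $ a $ b) field_differentiable (at x)"
        using D[of a b] DERIV_const[of "axis l 1 $ a" "at x"]
        by (cases "b = k") (auto simp: field_differentiable_def)
      show "(\<lambda>t. M t$a$b) field_differentiable (at x)"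
        using D by (auto simp: field_differentiable_def)
    qed (use U in \<open>simp add: invertible_det_nz\<close>)
    then obtain D' where D': "((\<lambda>t. det (\<chi> a b. if b = k then axis l 1 $ a else M t$a$b) / det (M t))
        has_field_derivative D') (at x)"
      by (auto simp: field_differentiable_def)
    have "((\<lambda>t. matrix_inv (M t) $ k $ l) has_field_derivative D') (at x)"
      by (rule has_field_derivative_transform_within_open[OF D' U(1,2)])
        (simp add: U(3) matrix_inv_cramer)
    then show ?thesis
      by (auto simp: field_differentiable_def)
  qed
  define E where "E = (\<lambda>k l. deriv (\<lambda>t. matrix_inv (M t) $ k $ l) x)"
  have E: "((\<lambda>t. matrix_inv (M t) $ k $ l) has_field_derivative E k l) (at x)" for k l
    unfolding E_def using diff field_differentiable_derivI by blast
  \<comment> \<open>The product M M^(-1) is constant on \<open>U\<close>, so its derivative,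
    computed by the product rule, is zero.\<close>
  have ME: "(\<Sum>b\<in>UNIV. M x $ a $ b * E b l) = - (\<Sum>b\<in>UNIV. D a b * P $ b $ l)" for a l
  proof -
    have "((\<lambda>t. \<Sum>b\<in>UNIV. M t $ a $ b * matrix_inv (M t) $ b $ l) has_field_derivative
        (\<Sum>b\<in>UNIV. D a b * P $ b $ l + E b l * M x $ a $ b)) (at x)"
      unfolding P_def by (intro DERIV_sum DERIV_mult D E)
    moreover have "((\<lambda>t. \<Sum>b\<in>UNIV. M t $ a $ b * matrix_inv (M t) $ b $ l) has_field_derivative 0) (at x)"
      by (rule has_field_derivative_transform_within_open[OF DERIV_const[of "of_bool (a = l)"] U(1,2)])
        (simp add: matrix_inv_entries U(3))
    ultimately have "(\<Sum>b\<in>UNIV. D a b * P $ b $ l + E b l * M x $ a $ b) = 0"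
      by (rule DERIV_unique)
    then show ?thesis
      by (simp add: sum.distrib mult.commute)
  qed
  have inv: "invertible (M x)" using U by blast
  \<comment> \<open>Multiplying \<open>ME\<close> by the inverse from the left isolates
    \<open>E\<close>.\<close>
  have "E k l = (\<Sum>b\<in>UNIV. of_bool (k = b) * E b l)"
    by simp
  also have "\<dots> = (\<Sum>b\<in>UNIV. (\<Sum>a\<in>UNIV. P $ k $ a * M x $ a $ b) * E b l)"
    unfolding P_def matrix_inv_entries(2)[OF inv] ..
  also have "\<dots> = (\<Sum>a\<in>UNIV. P $ k $ a * (\<Sum>b\<in>UNIV. M x $ a $ b * E b l))"
    unfolding sum_distrib_right sum_distrib_left by (subst sum.swap) (simp add: mult.assoc)
  also have "\<dots> = - (\<Sum>a\<in>UNIV. \<Sum>b\<in>UNIV. P $ k $ a * D a b * P $ b $ l)"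
    unfolding ME by (simp add: sum_negf sum_distrib_left mult.assoc)
  finally show ?thesis using E[of k l] by simp
qed

text \<open>An absorption argument: \<open>M\<close> is the deviation of a matrix from the identity
  and \<open>P\<close> its inverse. With p the sum of all |P k l|, the equation gives p \<le> n + p
  / 2, where n is the dimension, hence p \<le> 2 n.\<close>

lemma inverse_entries_bounded:
  fixes M P :: "'n::finite \<Rightarrow> 'n \<Rightarrow> real"
  assumes P: "\<And>k l. P k l = of_bool (k = l) - (\<Sum>a\<in>UNIV. M k a * P a l)"
    and M: "(\<Sum>k\<in>UNIV. \<Sum>a\<in>UNIV. \<bar>M k a\<bar>) \<le> 1/2"
  shows "\<bar>P k l\<bar> \<le> 2 * CARD('n)"
proof -
  define p where "p = (\<Sum>k\<in>UNIV. \<Sum>l\<in>UNIV. \<bar>P k l\<bar>)"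
  have row: "(\<Sum>l\<in>UNIV. \<bar>P a l\<bar>) \<le> p" for a
    unfolding p_def by (rule member_le_sum) (auto intro: sum_nonneg)
  then have p0: "0 \<le> p"
    by (meson abs_ge_zero order_trans sum_nonneg)
  have "p \<le> (\<Sum>k\<in>UNIV. \<Sum>l\<in>UNIV. of_bool (k = l) + (\<Sum>a\<in>UNIV. \<bar>M k a\<bar> * \<bar>P a l\<bar>))"
    unfolding p_def
  proof (intro sum_mono)
    fix k l
    have "\<bar>P k l\<bar> \<le> \<bar>of_bool (k = l)\<bar> + \<bar>\<Sum>a\<in>UNIV. M k a * P a l\<bar>"
      by (subst P) (rule abs_triangle_ineq4)
    also have "\<bar>\<Sum>a\<in>UNIV. M k a * P a l\<bar> \<le> (\<Sum>a\<in>UNIV. \<bar>M k a\<bar> * \<bar>P a l\<bar>)"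
      unfolding abs_mult[symmetric] by (rule sum_abs)
    finally show "\<bar>P k l\<bar> \<le> of_bool (k = l) + (\<Sum>a\<in>UNIV. \<bar>M k a\<bar> * \<bar>P a l\<bar>)"
      by simp
  qed
  also have "\<dots> = CARD('n) + (\<Sum>k\<in>UNIV. \<Sum>a\<in>UNIV. \<bar>M k a\<bar> * (\<Sum>l\<in>UNIV. \<bar>P a l\<bar>))"
  proof -
    have "(\<Sum>l\<in>UNIV. \<Sum>a\<in>UNIV. \<bar>M k a\<bar> * \<bar>P a l\<bar>) = (\<Sum>a\<in>UNIV. \<bar>M k a\<bar> * (\<Sum>l\<in>UNIV. \<bar>P a l\<bar>))" for k
      unfolding sum_distrib_left by (rule sum.swap)
    then show ?thesis by (simp add: sum.distrib)
  qed
  also have "\<dots> \<le> CARD('n) + (\<Sum>k\<in>UNIV. \<Sum>a\<in>UNIV. \<bar>M k a\<bar> * p)"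
    by (intro add_left_mono sum_mono mult_left_mono row) auto
  also have "(\<Sum>k\<in>UNIV. \<Sum>a\<in>UNIV. \<bar>M k a\<bar> * p) = (\<Sum>k\<in>UNIV. \<Sum>a\<in>UNIV. \<bar>M k a\<bar>) * p"
    by (simp add: sum_distrib_right)
  also have "\<dots> \<le> 1/2 * p"
    using M p0 by (rule mult_right_mono)
  finally have "p \<le> 2 * CARD('n)" by simp
  moreover have "\<bar>P k l\<bar> \<le> (\<Sum>l\<in>UNIV. \<bar>P k l\<bar>)"
    by (rule member_le_sum) auto
  ultimately show ?thesis using row[of k] by linarith
qed

section \<open>Expansion of the scalar curvature\<close>

definition ddmet :: "metric_coeffs \<Rightarrow> 3 \<Rightarrow> 3 \<Rightarrow> 3 \<Rightarrow> 3 \<Rightarrow> real^3 \<Rightarrow> real" where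
  "ddmet g m k i j x = partial_deriv m (dmet g k i j) x"

text \<open>Uses f g - f' g' = (f - f') g + f' (g - g'), so rates are required of the exact factor g
  and of the approximation f' only.\<close>

lemma decays_approx_mult:
  assumes "decays a (\<lambda>x. f x - f' x)" "decays b g" "decays c f'" "decays d (\<lambda>x. g x - g' x)"
    and "p \<le> a + b" "p \<le> c + d"
  shows "decays p (\<lambda>x. f x * g x - f' x * g' x)"
proof -
  have "decays p (\<lambda>x. (f x - f' x) * g x)" "decays p (\<lambda>x. f' x * (g x - g' x))"
    using assms by (auto intro: decays_mono[OF decays_mult])
  from sum_in_bigo(1)[OF this] show ?thesis
    by (simp add: algebra_simps)
qed

lemma decays_of_approx:
  assumes "decays a (\<lambda>x. f x - f' x)" "decays p f'" "p \<le> a"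
  shows "decays p f"
  using sum_in_bigo(1)[OF decays_mono[OF assms(1,3)] assms(2)] by simp

lemma decays_const: "p \<le> 0 \<Longrightarrow> decays p (\<lambda>x. a)"
proof (rule decays_mono)
  show "decays 0 (\<lambda>x. a)"
    unfolding decays_iff by (rule exI[of _ "\<bar>a\<bar>"], rule exI[of _ 0]) auto
qed

lemma decays_sum_diff:
  assumes "\<And>i. i \<in> I \<Longrightarrow> decays p (\<lambda>x. f i x - f' i x)"
  shows "decays p (\<lambda>x. (\<Sum>i\<in>I. f i x) - (\<Sum>i\<in>I. f' i x))"
  unfolding sum_subtractf[symmetric] using assms by (rule decays_sum)

lemma low_diff: "low d i j l - low d' i j l = low (\<lambda>k i j. d k i j - d' k i j) i j l"
  by (simp add: low_def)

lemma decays_low: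
  assumes "\<And>k i j. decays p (d k i j)"
  shows "decays p (\<lambda>x. low (\<lambda>k i j. d k i j x) i j l)"
  unfolding low_def by (intro sum_in_bigo assms)

lemma low_scale: "low (\<lambda>k i j. d k i j * s) i j l = low d i j l * s"
  by (simp add: low_def algebra_simps)

lemma ric_lin_scale: "ric_lin (\<lambda>m k i j. dd m k i j * s) i j = ric_lin dd i j * s"
  by (simp add: ric_lin_def low_scale flip: left_diff_distrib sum_distrib_right)

lemma dgam_quad_scale:
  "dgam_quad (\<lambda>i j. h i j * s) (\<lambda>k i j. d k i j * s^2) (\<lambda>m k i j. dd m k i j * s^3) m k i j
    = dgam_quad h d dd m k i j * s^4"
proof -
  have "(\<Sum>l\<in>UNIV. d m k l * s^2 * (low d i j l * s^2) + h k l * s * (low (dd m) i j l * s^3))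
      = (\<Sum>l\<in>UNIV. d m k l * low d i j l + h k l * low (dd m) i j l) * s^4"
    unfolding sum_distrib_right by (intro sum.cong refl) (simp add: algebra_simps eval_nat_numeral)
  then show ?thesis
    by (simp add: dgam_quad_def low_scale)
qed

lemma ric_quad_scale:
  "ric_quad (\<lambda>i j. h i j * s) (\<lambda>k i j. d k i j * s^2) (\<lambda>m k i j. dd m k i j * s^3) i j
    = ric_quad h d dd i j * s^4"
proof -
  have "(\<Sum>l\<in>UNIV. low d k l k * s^2 * (low d i j l * s^2) - low d j l k * s^2 * (low d i k l * s^2))
      = (\<Sum>l\<in>UNIV. low d k l k * low d i j l - low d j l k * low d i k l) * s^4" for k
    unfolding sum_distrib_right by (intro sum.cong refl) (simp add: algebra_simps eval_nat_numeral)
  then show ?thesis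
    unfolding ric_quad_def dgam_quad_scale low_scale
    by (simp add: add_divide_distrib flip: left_diff_distrib distrib_right sum_distrib_right times_divide_eq_left)
qed

text \<open>Every term of the quadratic part contains two factors of the perturbation and two
  derivatives in all, so the weights 1, 2, 3 always add up to 4. With s = 1 / r this reduces the
  model to the unit sphere.\<close>

lemma scal_quad_scale:
  "scal_quad (\<lambda>i j. h i j * s) (\<lambda>k i j. d k i j * s^2) (\<lambda>m k i j. dd m k i j * s^3)
    = scal_quad h d dd * s^4"
proof -
  have "(\<Sum>i\<in>UNIV. \<Sum>j\<in>UNIV. h i j * s * (ric_lin dd i j * s^3))
      = (\<Sum>i\<in>UNIV. \<Sum>j\<in>UNIV. h i j * ric_lin dd i j) * s^4"
    unfolding sum_distrib_right by (intro sum.cong refl) (simp add: eval_nat_numeral)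
  then show ?thesis
    unfolding scal_quad_def ric_quad_scale ric_lin_scale
    by (simp add: left_diff_distrib sum_distrib_right)
qed

lemma dmet_eq: "dmet g k i j = partial_deriv k (\<lambda>y. g y $ i $ j)"
  by (simp add: dmet_def fun_eq_iff)

text \<open>The coordinate data on which the analysis runs, with the model in jet form. Positivity
  of \<open>q\<close> makes the remainder smaller than the model. The bound \<open>q < 1\<close>
  lets terms one full power of 1 / r smaller than the leading ones, such as cubic terms of size
  r^(-5), be absorbed into the error r^(-4-q).\<close>

locale asymptotic_metric =
  fixes g :: metric_coeffs and A q :: real
  assumes q_pos: "0 < q" and q_less: "q < 1"
    and C2: "Ck_on 2 (\<lambda>x. g x $ i $ j) (- cball 0 1)"
    and pos_def: "\<lbrakk>norm x > 1; v \<noteq> 0\<rbrakk> \<Longrightarrow> v \<bullet> (g x *v v) > 0"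
    and expansion: "big_O_deriv 2 (1 + q)
      (\<lambda>x. g x $ i $ j - of_bool (i = j) - jet0 A (x /\<^sub>R norm x) i j * inverse (norm x))"
begin

definition mod0 :: "3 \<Rightarrow> 3 \<Rightarrow> real^3 \<Rightarrow> real" where
  "mod0 i j x = jet0 A (x /\<^sub>R norm x) i j * inverse (norm x)"

definition mod1 :: "3 \<Rightarrow> 3 \<Rightarrow> 3 \<Rightarrow> real^3 \<Rightarrow> real" where
  "mod1 k i j x = jet1 A (x /\<^sub>R norm x) k i j * (inverse (norm x))^2"

definition mod2 :: "3 \<Rightarrow> 3 \<Rightarrow> 3 \<Rightarrow> 3 \<Rightarrow> real^3 \<Rightarrow> real" where
  "mod2 l k i j x = jet2 A (x /\<^sub>R norm x) l k i j * (inverse (norm x))^3"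

lemma decays_model: "decays 1 (mod0 i j)" "decays 2 (mod1 k i j)" "decays 3 (mod2 l k i j)"
  using decays_homogeneous[of "\<lambda>n. jet0 A n i j" 1] decays_homogeneous[of "\<lambda>n. jet1 A n k i j" 2]
    decays_homogeneous[of "\<lambda>n. jet2 A n l k i j" 3]
  by (simp_all add: continuous_on_jet mod0_def[abs_def] mod1_def[abs_def] mod2_def[abs_def])

lemma open_exterior: "open (- cball (0::real^3) 1)"
  by auto

lemma g_differentiable: "1 < norm x \<Longrightarrow> (\<lambda>x. g x $ i $ j) differentiable (at x)"
  and dmet_differentiable: "1 < norm x \<Longrightarrow> dmet g k i j differentiable (at x)"
  and ddmet_continuous: "continuous_on (- cball 0 1) (ddmet g m k i j)"
  using C2[of i j] by (auto simp: numeral_2_eq_2 dmet_eq ddmet_def[abs_def])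

lemma has_partial_g: "1 < norm x \<Longrightarrow> has_partial (\<lambda>x. g x $ i $ j) k (dmet g k i j x) x"
  unfolding dmet_eq by (intro differentiable_imp_has_partial g_differentiable)

lemma has_partial_dmet: "1 < norm x \<Longrightarrow> has_partial (dmet g k i j) m (ddmet g m k i j x) x"
  unfolding ddmet_def by (intro differentiable_imp_has_partial dmet_differentiable)

text \<open>\<open>expansion\<close> controls derivatives of the remainder as a single function;
  splitting them turns that control into a comparison of the derivatives of g with those of the
  model.\<close>

lemma partial_remainder:
  assumes "1 < norm x"
  shows "partial_deriv k (\<lambda>x. g x $ i $ j - of_bool (i = j) - mod0 i j x) x = dmet g k i j x - mod1 k i j x"
proof -
  have "x \<noteq> 0" using assms by auto
  have "has_partial (\<lambda>x. g x $ i $ j - of_bool (i = j) - mod0 i j x) k (dmet g k i j x - 0 - mod1 k i j x) x"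
    unfolding mod0_def mod1_def
    by (intro has_partial_diff has_partial_g assms has_partial_const has_partial_jet0 \<open>x \<noteq> 0\<close>)
  then show ?thesis by (simp add: has_partial_imp_partial_deriv)
qed

lemma partial_partial_remainder:
  assumes "1 < norm x"
  shows "partial_deriv m (partial_deriv k (\<lambda>x. g x $ i $ j - of_bool (i = j) - mod0 i j x)) x
    = ddmet g m k i j x - mod2 m k i j x"
proof -
  have "x \<noteq> 0" using assms by auto
  have "has_partial (\<lambda>x. dmet g k i j x - mod1 k i j x) m (ddmet g m k i j x - mod2 m k i j x) x"
    unfolding mod2_def mod1_def
    by (intro has_partial_diff has_partial_dmet assms has_partial_jet1 \<open>x \<noteq> 0\<close>)
  \<comment> \<open>The formula for the first derivative of the remainder is available outside the
    unit ball only, so it is differentiated on that open set.\<close>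
  then show ?thesis
    by (intro has_partial_imp_partial_deriv, elim has_partial_transform[OF _ open_exterior])
      (use assms in \<open>auto simp: partial_remainder\<close>)
qed

lemma approx0: "decays (1 + q) (\<lambda>x. g x $ i $ j - of_bool (i = j) - mod0 i j x)"
  using big_O_deriv_imp_decays[OF expansion, of "[]"] by (simp add: mod0_def)

lemma approx1: "decays (2 + q) (\<lambda>x. dmet g k i j x - mod1 k i j x)"
proof -
  have "decays (2 + q) (partial_deriv k (\<lambda>x. g x $ i $ j - of_bool (i = j) - mod0 i j x))"
    using big_O_deriv_imp_decays[OF expansion, of "[k]"] by (simp add: mod0_def add_ac)
  then show ?thesis
    by (rule decays_transform[of _ _ 1]) (rule partial_remainder)
qed

lemma approx2: "decays (3 + q) (\<lambda>x. ddmet g m k i j x - mod2 m k i j x)"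
proof -
  have "decays (3 + q) (partial_deriv m (partial_deriv k (\<lambda>x. g x $ i $ j - of_bool (i = j) - mod0 i j x)))"
    using big_O_deriv_imp_decays[OF expansion, of "[m, k]"] by (simp add: mod0_def add_ac)
  then show ?thesis
    by (rule decays_transform[of _ _ 1]) (rule partial_partial_remainder)
qed

lemma decays_dmet: "decays 2 (dmet g k i j)"
  using approx1 decays_model(2) by (rule decays_of_approx) (use q_pos in simp)

lemma decays_ddmet: "decays 3 (ddmet g m k i j)"
  using approx2 decays_model(3) by (rule decays_of_approx) (use q_pos in simp)

section \<open>The inverse metric and its expansion\<close>

abbreviation P :: "3 \<Rightarrow> 3 \<Rightarrow> real^3 \<Rightarrow> real" where
  "P k l x \<equiv> matrix_inv (g x) $ k $ l"

lemma invertible_g: "1 < norm x \<Longrightarrow> invertible (g x)"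
  by (rule positive_definite_imp_invertible) (rule pos_def)

lemma decays_dev: "decays 1 (\<lambda>x. g x $ i $ j - of_bool (i = j))"
  using approx0 decays_model(1) by (rule decays_of_approx) (use q_pos in simp)

text \<open>The fixed-point form P = 1 - (g - 1) P is used three times: it bounds P, then shows P -
  1 = O(1 / r), and then identifies the leading part of P - 1 as \<open>- mod0\<close>.\<close>

lemma inverse_eq:
  assumes "1 < norm x"
  shows "P k l x = of_bool (k = l) - (\<Sum>a\<in>UNIV. (g x $ k $ a - of_bool (k = a)) * P a l x)"
proof -
  have "(\<Sum>a\<in>UNIV. (g x $ k $ a - of_bool (k = a)) * P a l x)
      = (\<Sum>a\<in>UNIV. g x $ k $ a * P a l x) - P k l x"
    by (simp add: left_diff_distrib sum_subtractf)
  then show ?thesis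
    using matrix_inv_entries(1)[OF invertible_g[OF assms], of k l] by simp
qed

lemma decays_inverse: "decays 0 (P k l)"
proof -
  have "decays 1 (\<lambda>x. \<Sum>k\<in>UNIV. \<Sum>a\<in>UNIV. \<bar>g x $ k $ a - of_bool (k = a)\<bar>)"
    by (intro decays_sum) (simp only: landau_o.big.abs_in_iff decays_dev)
  then obtain C r0 where C: "\<And>x. r0 < norm x \<Longrightarrow>
      \<bar>\<Sum>k\<in>UNIV. \<Sum>a\<in>UNIV. \<bar>g x $ k $ a - of_bool (k = a)\<bar>\<bar> \<le> C * norm x powr (-1)"
    unfolding decays_iff by blast
  \<comment> \<open>The bound 6 is 2 n in dimension n = 3, and |x| > 2 C makes the total deviation C
    / |x| at most 1/2, as \<open>inverse_entries_bounded\<close> requires.\<close>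
  have "\<bar>P k l x\<bar> \<le> 6" if "norm x > max r0 (max 1 (2 * C))" for x
  proof -
    have x: "norm x > r0" "norm x > 1" "norm x > 2 * C"
      using that by auto
    have "C * norm x powr (-1) \<le> 1/2"
      using x by (simp add: powr_minus divide_simps)
    with C[OF x(1)] have "(\<Sum>k\<in>UNIV. \<Sum>a\<in>UNIV. \<bar>g x $ k $ a - of_bool (k = a)\<bar>) \<le> 1/2"
      by linarith
    from inverse_entries_bounded[of "\<lambda>k l. P k l x", OF inverse_eq[OF x(2)] this, of k l]
    show ?thesis by simp
  qed
  then show ?thesis
    unfolding decays_iff
    by (intro exI[of _ 6] exI[of _ "max r0 (max 1 (2 * C))"]) auto
qed

lemma approx_inverse1: "decays 1 (\<lambda>x. P k l x - of_bool (k = l))"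
proof -
  have "decays (1 + 0) (\<lambda>x. \<Sum>a\<in>UNIV. (g x $ k $ a - of_bool (k = a)) * P a l x)"
    by (intro decays_sum decays_mult decays_dev decays_inverse)
  then have "decays 1 (\<lambda>x. - (\<Sum>a\<in>UNIV. (g x $ k $ a - of_bool (k = a)) * P a l x))"
    by simp
  then show ?thesis
    by (rule decays_transform[of _ _ 1]) (use inverse_eq[of _ k l] in simp)
qed

lemma approx_inverse: "decays (1 + q) (\<lambda>x. P k l x - of_bool (k = l) + mod0 k l x)"
proof -
  have "decays (1 + q) (\<lambda>x. (\<Sum>a\<in>UNIV. (g x $ k $ a - of_bool (k = a)) * P a l x)
      - (\<Sum>a\<in>UNIV. mod0 k a x * of_bool (a = l)))"
    by (intro decays_sum_diff decays_approx_mult[OF approx0 decays_inverse decays_model(1) approx_inverse1])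
      (use q_less in auto)
  then have "decays (1 + q) (\<lambda>x. - ((\<Sum>a\<in>UNIV. (g x $ k $ a - of_bool (k = a)) * P a l x)
      - (\<Sum>a\<in>UNIV. mod0 k a x * of_bool (a = l))))"
    by (simp only: landau_o.big.uminus_in_iff)
  then show ?thesis
    by (rule decays_transform[of _ _ 1]) (use inverse_eq[of _ k l] in simp)
qed

lemma has_partial_inverse:
  assumes "1 < norm x"
  shows "has_partial (P k l) m (- (\<Sum>a\<in>UNIV. \<Sum>b\<in>UNIV. P k a x * dmet g m a b x * P b l x)) x"
proof -
  have "continuous_on UNIV (\<lambda>t::real. x + t *\<^sub>R axis m 1)"
    by (intro continuous_intros)
  then have "open ((\<lambda>t::real. x + t *\<^sub>R axis m 1) -` (- cball 0 1))"
    using open_exterior continuous_on_open_vimage[OF open_UNIV] by auto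
  then show ?thesis
    using matrix_inv_has_derivative[of "\<lambda>t. g (x + t *\<^sub>R axis m 1)" "\<lambda>i j. dmet g m i j x" 0
        "(\<lambda>t::real. x + t *\<^sub>R axis m 1) -` (- cball 0 1)" k l]
      has_partial_g[OF assms] assms invertible_g
    by (auto simp: has_partial_def)
qed


section \<open>Christoffel symbols, Ricci and scalar curvature compared with the model\<close>

abbreviation dlow :: "3 \<Rightarrow> 3 \<Rightarrow> 3 \<Rightarrow> real^3 \<Rightarrow> real" where
  "dlow i j l x \<equiv> low (\<lambda>k i j. dmet g k i j x) i j l"

abbreviation ddlow :: "3 \<Rightarrow> 3 \<Rightarrow> 3 \<Rightarrow> 3 \<Rightarrow> real^3 \<Rightarrow> real" where
  "ddlow m i j l x \<equiv> low (\<lambda>k i j. ddmet g m k i j x) i j l"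

abbreviation mlow :: "3 \<Rightarrow> 3 \<Rightarrow> 3 \<Rightarrow> real^3 \<Rightarrow> real" where
  "mlow i j l x \<equiv> low (\<lambda>k i j. mod1 k i j x) i j l"

abbreviation mmlow :: "3 \<Rightarrow> 3 \<Rightarrow> 3 \<Rightarrow> 3 \<Rightarrow> real^3 \<Rightarrow> real" where
  "mmlow m i j l x \<equiv> low (\<lambda>k i j. mod2 m k i j x) i j l"

abbreviation mdgam :: "3 \<Rightarrow> 3 \<Rightarrow> 3 \<Rightarrow> 3 \<Rightarrow> real^3 \<Rightarrow> real" where
  "mdgam m k i j x \<equiv> dgam_quad (\<lambda>i j. mod0 i j x) (\<lambda>k i j. mod1 k i j x) (\<lambda>m k i j. mod2 m k i j x) m k i j"

abbreviation mric :: "3 \<Rightarrow> 3 \<Rightarrow> real^3 \<Rightarrow> real" where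
  "mric i j x \<equiv> ric_quad (\<lambda>i j. mod0 i j x) (\<lambda>k i j. mod1 k i j x) (\<lambda>m k i j. mod2 m k i j x) i j"

abbreviation lric :: "3 \<Rightarrow> 3 \<Rightarrow> real^3 \<Rightarrow> real" where
  "lric i j x \<equiv> ric_lin (\<lambda>m k i j. ddmet g m k i j x) i j"

abbreviation lmric :: "3 \<Rightarrow> 3 \<Rightarrow> real^3 \<Rightarrow> real" where
  "lmric i j x \<equiv> ric_lin (\<lambda>m k i j. mod2 m k i j x) i j"

lemma low_decays:
  "decays 2 (dlow i j l)" "decays 3 (ddlow m i j l)" "decays 2 (mlow i j l)" "decays 3 (mmlow m i j l)"
  "decays (2 + q) (\<lambda>x. dlow i j l x - mlow i j l x)" "decays (3 + q) (\<lambda>x. ddlow m i j l x - mmlow m i j l x)"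
  unfolding low_diff
  by (intro decays_low decays_dmet decays_ddmet decays_model approx1 approx2)+

lemma christoffel_eq: "christoffel g k i j = (\<lambda>x. 1/2 * (\<Sum>l\<in>UNIV. P k l x * dlow i j l x))"
  by (simp add: christoffel_def low_def fun_eq_iff)

lemma has_partial_dlow:
  "1 < norm x \<Longrightarrow> has_partial (dlow i j l) m (ddlow m i j l x) x"
  unfolding low_def by (intro has_partial_add has_partial_diff has_partial_dmet)

lemma partial_christoffel:
  assumes "1 < norm x"
  shows "partial_deriv m (christoffel g k i j) x =
    1/2 * (\<Sum>l\<in>UNIV. - (\<Sum>a\<in>UNIV. \<Sum>b\<in>UNIV. P k a x * dmet g m a b x * P b l x) * dlow i j l x
       + P k l x * ddlow m i j l x)"
  unfolding christoffel_eq
  by (intro has_partial_imp_partial_deriv has_partial_cmult has_partial_sum has_partial_mult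
      has_partial_inverse has_partial_dlow assms)

lemma christoffel_approx: "decays (2 + q) (\<lambda>x. christoffel g k i j x - mlow i j k x / 2)"
proof -
  have "decays (2 + q) (\<lambda>x. (\<Sum>l\<in>UNIV. P k l x * dlow i j l x) - (\<Sum>l\<in>UNIV. of_bool (k = l) * mlow i j l x))"
    by (intro decays_sum_diff decays_approx_mult[OF approx_inverse1 low_decays(1) decays_const[of 0] low_decays(5)])
      (use q_less in auto)
  then have "decays (2 + q) (\<lambda>x. 1/2 * ((\<Sum>l\<in>UNIV. P k l x * dlow i j l x) - (\<Sum>l\<in>UNIV. of_bool (k = l) * mlow i j l x)))"
    by (subst landau_o.big.cmult_in_iff) auto
  then show ?thesis
    by (simp add: christoffel_eq algebra_simps)
qed

lemma decays_half: "decays p f \<Longrightarrow> decays p (\<lambda>x. f x / 2)"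
  using landau_o.big.cmult_in_iff[of "1/2" f] by simp

lemma decays_uminus: "decays p f \<Longrightarrow> decays p (\<lambda>x. - f x)"
  by (simp only: landau_o.big.uminus_in_iff)

lemma decays_christoffel: "decays 2 (christoffel g k i j)"
  using christoffel_approx decays_half[OF low_decays(3)]
  by (rule decays_of_approx) (use q_pos in simp)

text \<open>An estimate of P does not bound its derivatives. The exact formula - P (dg) P is
  estimated instead, its outer factors being \<delta> + O(1 / r).\<close>

lemma inverse_deriv_approx:
  "decays (2 + q) (\<lambda>x. - (\<Sum>a\<in>UNIV. \<Sum>b\<in>UNIV. P k a x * dmet g m a b x * P b l x) - - mod1 m k l x)"
proof -
  have 1: "decays (2 + q) (\<lambda>x. P k a x * dmet g m a b x - of_bool (k = a) * mod1 m a b x)" for a b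
    by (rule decays_approx_mult[OF approx_inverse1 decays_dmet decays_const[of 0] approx1])
      (use q_less in auto)
  have 2: "decays 2 (\<lambda>x. of_bool (k = a) * mod1 m a b x)" for a b
    by (rule decays_mono[OF decays_mult[OF decays_const[of 0] decays_model(2)]]) auto
  have "decays (2 + q) (\<lambda>x. (\<Sum>a\<in>UNIV. \<Sum>b\<in>UNIV. P k a x * dmet g m a b x * P b l x)
      - (\<Sum>a\<in>UNIV. \<Sum>b\<in>UNIV. of_bool (k = a) * mod1 m a b x * of_bool (b = l)))"
    by (intro decays_sum_diff decays_approx_mult[OF 1 decays_inverse 2 approx_inverse1])
      (use q_less in auto)
  moreover have "(\<Sum>a\<in>UNIV. \<Sum>b\<in>UNIV. of_bool (k = a) * mod1 m a b x * of_bool (b = l)) = mod1 m k l x" for x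
  proof -
    have "(\<Sum>a\<in>UNIV. \<Sum>b\<in>UNIV. of_bool (k = a) * mod1 m a b x * of_bool (b = l))
        = (\<Sum>a\<in>UNIV. of_bool (k = a) * (\<Sum>b\<in>UNIV. mod1 m a b x * of_bool (b = l)))"
      by (simp only: mult.assoc sum_distrib_left)
    then show ?thesis by simp
  qed
  ultimately have "decays (2 + q) (\<lambda>x. (\<Sum>a\<in>UNIV. \<Sum>b\<in>UNIV. P k a x * dmet g m a b x * P b l x) - mod1 m k l x)"
    by simp
  from decays_uminus[OF this] show ?thesis
    by simp
qed

lemma inverse_approx: "decays (1 + q) (\<lambda>x. (P i j x - of_bool (i = j)) - (- mod0 i j x))"
  using approx_inverse by (simp only: diff_minus_eq_add)

text \<open>The linear term keeps the derivatives of g itself: replacing them by those of the model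
  would cost O(r^(-3-q)), more than the error allowed. Only products are replaced by the model. The
  same division persists up to the scalar curvature.\<close>

lemma partial_christoffel_approx:
  "decays (4 + q) (\<lambda>x. partial_deriv m (christoffel g k i j) x - ddlow m i j k x / 2 - mdgam m k i j x)"
proof -
  have 1: "decays (4 + q) (\<lambda>x.
      (\<Sum>l\<in>UNIV. - (\<Sum>a\<in>UNIV. \<Sum>b\<in>UNIV. P k a x * dmet g m a b x * P b l x) * dlow i j l x)
      - (\<Sum>l\<in>UNIV. - mod1 m k l x * mlow i j l x))"
    by (intro decays_sum_diff decays_approx_mult[OF inverse_deriv_approx low_decays(1)
          decays_uminus[OF decays_model(2)] low_decays(5)])
      (use q_less in auto)
  \<comment> \<open>Splitting P into \<delta> and P - \<delta> separates the exact linear term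
    \<open>ddlow m i j k x / 2\<close> from a product that may be approximated.\<close>
  have 2: "decays (4 + q) (\<lambda>x. (\<Sum>l\<in>UNIV. (P k l x - of_bool (k = l)) * ddlow m i j l x)
      - (\<Sum>l\<in>UNIV. - mod0 k l x * mmlow m i j l x))"
    by (intro decays_sum_diff decays_approx_mult[OF inverse_approx low_decays(2)
          decays_uminus[OF decays_model(1)] low_decays(6)]) auto
  have "decays (4 + q) (\<lambda>x. ((
      (\<Sum>l\<in>UNIV. - (\<Sum>a\<in>UNIV. \<Sum>b\<in>UNIV. P k a x * dmet g m a b x * P b l x) * dlow i j l x)
      - (\<Sum>l\<in>UNIV. - mod1 m k l x * mlow i j l x)) +
      ((\<Sum>l\<in>UNIV. (P k l x - of_bool (k = l)) * ddlow m i j l x)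
      - (\<Sum>l\<in>UNIV. - mod0 k l x * mmlow m i j l x))) / 2)"
    by (rule decays_half[OF sum_in_bigo(1)[OF 1 2]])
  then show ?thesis
  proof (rule decays_transform[of _ _ 1])
    fix x :: "real^3" assume x: "1 < norm x"
    show "((\<Sum>l\<in>UNIV. - (\<Sum>a\<in>UNIV. \<Sum>b\<in>UNIV. P k a x * dmet g m a b x * P b l x) * dlow i j l x)
      - (\<Sum>l\<in>UNIV. - mod1 m k l x * mlow i j l x) +
      ((\<Sum>l\<in>UNIV. (P k l x - of_bool (k = l)) * ddlow m i j l x)
      - (\<Sum>l\<in>UNIV. - mod0 k l x * mmlow m i j l x))) / 2
      = partial_deriv m (christoffel g k i j) x - ddlow m i j k x / 2 - mdgam m k i j x"
      unfolding partial_christoffel[OF x] dgam_quad_def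
      by (simp add: sum.distrib sum_subtractf sum_negf left_diff_distrib diff_divide_distrib add_divide_distrib)
  qed
qed

lemma product_christoffel_approx:
  "decays (4 + q) (\<lambda>x. christoffel g a b c x * christoffel g a' b' c' x
     - mlow b c a x / 2 * (mlow b' c' a' x / 2))"
  by (rule decays_approx_mult[OF christoffel_approx decays_christoffel decays_half[OF low_decays(3)]
        christoffel_approx]) auto

lemma ricci_approx: "decays (4 + q) (\<lambda>x. ricci g i j x - lric i j x - mric i j x)"
proof -
  have "decays (4 + q) (\<lambda>x. \<Sum>k\<in>UNIV.
      (partial_deriv k (christoffel g k i j) x - ddlow k i j k x / 2 - mdgam k k i j x)
      - (partial_deriv j (christoffel g k i k) x - ddlow j i k k x / 2 - mdgam j k i k x)
      + ((\<Sum>l\<in>UNIV. (christoffel g k k l x * christoffel g l i j x - mlow k l k x / 2 * (mlow i j l x / 2))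
         - (christoffel g k j l x * christoffel g l i k x - mlow j l k x / 2 * (mlow i k l x / 2)))))"
    by (intro decays_sum sum_in_bigo partial_christoffel_approx product_christoffel_approx)
  moreover have "(\<Sum>l\<in>UNIV. (christoffel g k k l x * christoffel g l i j x - mlow k l k x / 2 * (mlow i j l x / 2))
         - (christoffel g k j l x * christoffel g l i k x - mlow j l k x / 2 * (mlow i k l x / 2)))
     = (\<Sum>l\<in>UNIV. christoffel g k k l x * christoffel g l i j x - christoffel g k j l x * christoffel g l i k x)
       - (\<Sum>l\<in>UNIV. mlow k l k x * mlow i j l x - mlow j l k x * mlow i k l x) / 4" for k x
    unfolding sum_divide_distrib sum_subtractf[symmetric]
    by (intro sum.cong refl) (simp add: field_simps)
  ultimately show ?thesis
    unfolding ricci_def ric_lin_def ric_quad_def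
    by (simp add: sum_subtractf sum.distrib diff_divide_distrib sum_divide_distrib algebra_simps)
qed

lemma decays_quad: "decays 4 (mdgam m k i j)" "decays 4 (mric i j)"
proof -
  have 22: "decays 4 (\<lambda>x. mod1 m k l x * mlow i j l' x)" for m k l i j l'
    using decays_mult[OF decays_model(2) low_decays(3)] by simp
  have 13: "decays 4 (\<lambda>x. mod0 k l x * mmlow m i j l' x)" for m k l i j l'
    using decays_mult[OF decays_model(1) low_decays(4)] by simp
  have ll: "decays 4 (\<lambda>x. mlow k l m x * mlow i j l' x)" for m k l i j l'
    using decays_mult[OF low_decays(3) low_decays(3)] by simp
  show 1: "decays 4 (mdgam m k i j)" for m k i j
    unfolding dgam_quad_def
    by (intro decays_half decays_uminus decays_sum sum_in_bigo 22 13)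
  have "decays 4 (\<lambda>x. (\<Sum>l\<in>UNIV. mlow k l k x * mlow i j l x - mlow j l k x * mlow i k l x) / 2 / 2)" for k
    by (intro decays_half decays_sum sum_in_bigo ll)
  then have 2: "decays 4 (\<lambda>x. (\<Sum>l\<in>UNIV. mlow k l k x * mlow i j l x - mlow j l k x * mlow i k l x) / 4)" for k
    by simp
  show "decays 4 (mric i j)"
    unfolding ric_quad_def
    by (intro decays_sum sum_in_bigo 1 2)
qed

lemma ric_lin_decays:
  "decays 3 (lric i j)" "decays 3 (lmric i j)" "decays (3 + q) (\<lambda>x. lric i j x - lmric i j x)"
proof -
  show "decays 3 (lric i j)" "decays 3 (lmric i j)"
    unfolding ric_lin_def by (intro decays_half decays_sum sum_in_bigo low_decays)+
  have "decays (3 + q) (\<lambda>x. (\<Sum>k\<in>UNIV. (ddlow k i j k x - mmlow k i j k x) - (ddlow j i k k x - mmlow j i k k x)) / 2)"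
    by (intro decays_half decays_sum sum_in_bigo low_decays)
  then show "decays (3 + q) (\<lambda>x. lric i j x - lmric i j x)"
    unfolding ric_lin_def
    by (simp add: sum_subtractf sum.distrib diff_divide_distrib add_divide_distrib algebra_simps)
qed

text \<open>In the trace, P is again split into \<delta> and P - \<delta>. Against the quadratic
  Ricci part the deviation is O(r^(-5)) and goes into the error; against the linear part it is
  itself quadratic and yields the term - h \<open>ric_lin\<close> of
  \<open>scal_quad\<close>.\<close>

lemma scalar_curvature_approx:
  "decays (4 + q) (\<lambda>x. scalar_curvature g x - (\<Sum>i\<in>UNIV. lric i i x)
    - scal_quad (\<lambda>i j. mod0 i j x) (\<lambda>k i j. mod1 k i j x) (\<lambda>m k i j. mod2 m k i j x))"
proof -
  have m: "decays 1 (\<lambda>x. - mod0 i j x)" for i j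
    by (intro decays_uminus decays_model)
  have 1: "decays (4 + q) (\<lambda>x. P i j x * (ricci g i j x - lric i j x - mric i j x))" for i j
    using decays_mult[OF decays_inverse ricci_approx] by simp
  have 2: "decays (4 + q) (\<lambda>x. (P i j x - of_bool (i = j)) * mric i j x)" for i j
    by (rule decays_mono[OF decays_mult[OF approx_inverse1 decays_quad(2)]]) (use q_less in simp)
  have 3: "decays (4 + q) (\<lambda>x. (P i j x - of_bool (i = j)) * lric i j x - (- mod0 i j x) * lmric i j x)" for i j
    by (rule decays_approx_mult[OF inverse_approx ric_lin_decays(1) m ric_lin_decays(3)]) auto
  have "decays (4 + q) (\<lambda>x. \<Sum>i\<in>UNIV. \<Sum>j\<in>UNIV.
      P i j x * (ricci g i j x - lric i j x - mric i j x) + (P i j x - of_bool (i = j)) * mric i j x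
      + ((P i j x - of_bool (i = j)) * lric i j x - (- mod0 i j x) * lmric i j x))"
    by (intro decays_sum sum_in_bigo 1 2 3)
  moreover have "(\<Sum>i\<in>UNIV. \<Sum>j\<in>UNIV.
      P i j x * (ricci g i j x - lric i j x - mric i j x) + (P i j x - of_bool (i = j)) * mric i j x
      + ((P i j x - of_bool (i = j)) * lric i j x - (- mod0 i j x) * lmric i j x))
    = scalar_curvature g x - (\<Sum>i\<in>UNIV. lric i i x)
    - scal_quad (\<lambda>i j. mod0 i j x) (\<lambda>k i j. mod1 k i j x) (\<lambda>m k i j. mod2 m k i j x)" for x
  proof -
    have "(\<Sum>i\<in>UNIV. \<Sum>j\<in>UNIV.
      P i j x * (ricci g i j x - lric i j x - mric i j x) + (P i j x - of_bool (i = j)) * mric i j x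
      + ((P i j x - of_bool (i = j)) * lric i j x - (- mod0 i j x) * lmric i j x))
      = (\<Sum>i\<in>UNIV. \<Sum>j\<in>UNIV. P i j x * ricci g i j x - of_bool (i = j) * lric i j x
          - of_bool (i = j) * mric i j x + mod0 i j x * lmric i j x)"
      by (intro sum.cong refl) (simp add: algebra_simps)
    then show ?thesis
      unfolding scalar_curvature_def scal_quad_def
      by (simp add: sum.distrib sum_subtractf)
  qed
  ultimately show ?thesis by simp
qed

text \<open>The linearized scalar curvature at the flat metric, div div g minus the Laplacian of tr
  g. The derivative indices are ordered as the divergence of the center of mass field produces them,
  so no partial derivatives have to be interchanged.\<close>

definition curv_lin :: "real^3 \<Rightarrow> real" where
  "curv_lin x = (\<Sum>j\<in>UNIV. \<Sum>i\<in>UNIV. ddmet g j i i j x - ddmet g j j i i x)"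

lemma trace_ric_lin: "(\<Sum>i\<in>UNIV. lric i i x) = curv_lin x"
proof -
  have "(\<Sum>i\<in>UNIV. lric i i x)
      = (\<Sum>i\<in>UNIV. \<Sum>k\<in>UNIV. ddmet g k i i k x - ddmet g k k i i x / 2 - ddmet g i i k k x / 2)"
    unfolding ric_lin_def sum_divide_distrib low_def
    by (intro sum.cong refl) (simp add: field_simps)
  also have "\<dots> = (\<Sum>i\<in>UNIV. \<Sum>k\<in>UNIV. ddmet g k i i k x) - (\<Sum>i\<in>UNIV. \<Sum>k\<in>UNIV. ddmet g k k i i x) / 2
      - (\<Sum>i\<in>UNIV. \<Sum>k\<in>UNIV. ddmet g i i k k x) / 2"
    by (simp add: sum_subtractf sum_divide_distrib)
  also have "(\<Sum>i\<in>UNIV. \<Sum>k\<in>UNIV. ddmet g k k i i x) = (\<Sum>i\<in>UNIV. \<Sum>k\<in>UNIV. ddmet g i i k k x)"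
    by (rule sum.swap)
  also have "(\<Sum>i\<in>UNIV. \<Sum>k\<in>UNIV. ddmet g k i i k x) = (\<Sum>k\<in>UNIV. \<Sum>i\<in>UNIV. ddmet g k i i k x)"
    by (rule sum.swap)
  finally show ?thesis
    by (simp add: curv_lin_def sum_subtractf)
qed

lemma curv_lin_approx:
  assumes flat: "\<And>x. 1 < norm x \<Longrightarrow> scalar_curvature g x = 0"
  shows "decays (4 + q) (\<lambda>x. curv_lin x
    + (3/2 * A\<^sup>2 + 3/8 + 3/2 * A * (x /\<^sub>R norm x)$1 - (x /\<^sub>R norm x)$1 * (x /\<^sub>R norm x)$1 / 2) * inverse (norm x)^4)"
proof (rule decays_transform[OF decays_uminus[OF scalar_curvature_approx]])
  fix x :: "real^3" assume x: "1 < norm x"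
  then have "x \<noteq> 0"
    by auto
  then have n: "norm (x /\<^sub>R norm x) = 1"
    by simp
  show "- (scalar_curvature g x - (\<Sum>i\<in>UNIV. lric i i x)
      - scal_quad (\<lambda>i j. mod0 i j x) (\<lambda>k i j. mod1 k i j x) (\<lambda>m k i j. mod2 m k i j x))
    = curv_lin x
    + (3/2 * A\<^sup>2 + 3/8 + 3/2 * A * (x /\<^sub>R norm x)$1 - (x /\<^sub>R norm x)$1 * (x /\<^sub>R norm x)$1 / 2) * inverse (norm x)^4"
    unfolding mod0_def mod1_def mod2_def scal_quad_scale scal_quad_jet[OF n] trace_ric_lin flat[OF x]
    by simp
qed

end

section \<open>The divergence theorem on coordinate spheres\<close>

lemma has_real_derivative_chain:
  fixes c :: "real \<Rightarrow> real^3"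
  assumes "f differentiable (at (c t))"
    and c: "\<And>i. ((\<lambda>t. c t $ i) has_real_derivative c' i) (at t)"
  shows "((\<lambda>t. f (c t)) has_real_derivative (\<Sum>i\<in>UNIV. c' i * partial_deriv i f (c t))) (at t)"
proof -
  have "(c has_derivative (\<lambda>h. \<chi> i. c' i * h)) (at t)"
    using c by (subst has_derivative_componentwise_within)
      (auto simp: Basis_vec_def inner_axis has_field_derivative_def)
  from has_derivative_compose[OF this differentiable_gradient[OF assms(1)]]
  have "((\<lambda>t. f (c t)) has_derivative (\<lambda>h. \<Sum>i\<in>UNIV. c' i * h * partial_deriv i f (c t))) (at t)"
    by simp
  moreover have "(\<lambda>h. \<Sum>i\<in>UNIV. c' i * h * partial_deriv i f (c t)) = (*) (\<Sum>i\<in>UNIV. c' i * partial_deriv i f (c t))"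
    by (simp add: fun_eq_iff sum_distrib_left sum_distrib_right algebra_simps)
  ultimately show ?thesis
    by (simp add: has_field_derivative_def)
qed

text \<open>The unit tangent vectors of the sphere along the two angles. The azimuthal one omits the
  factor sin \<theta> of the \<phi>-derivative, so the frame stays orthonormal at the poles.\<close>

definition polar_frame :: "real \<Rightarrow> real \<Rightarrow> real^3" where
  "polar_frame \<theta> \<phi> = vector [cos \<theta> * cos \<phi>, cos \<theta> * sin \<phi>, - sin \<theta>]"

definition azimuthal_frame :: "real \<Rightarrow> real^3" where
  "azimuthal_frame \<phi> = vector [- sin \<phi>, cos \<phi>, 0]"

lemma sphere_param_scale: "sphere_param \<rho> \<theta> \<phi> = \<rho> *\<^sub>R sphere_param 1 \<theta> \<phi>"
  by (simp add: sphere_param_def)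

lemma norm_sphere_param: "norm (sphere_param \<rho> \<theta> \<phi>) = \<bar>\<rho>\<bar>"
proof -
  have "(sin \<theta> * cos \<phi>)\<^sup>2 + (sin \<theta> * sin \<phi>)\<^sup>2 + (cos \<theta>)\<^sup>2
      = (sin \<theta>)\<^sup>2 * ((sin \<phi>)\<^sup>2 + (cos \<phi>)\<^sup>2) + (cos \<theta>)\<^sup>2"
    by (simp only: power_mult_distrib algebra_simps)
  then have "norm (vector [sin \<theta> * cos \<phi>, sin \<theta> * sin \<phi>, cos \<theta>] :: real^3) = 1"
    by (simp add: norm_vec_def L2_set_def sum_3)
  then show ?thesis
    by (simp add: sphere_param_def)
qed

lemma sphere_param_radial_deriv:
  "((\<lambda>\<rho>. sphere_param \<rho> \<theta> \<phi> $ i) has_real_derivative sphere_param 1 \<theta> \<phi> $ i) (at \<rho>)"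
  unfolding sphere_param_def by (auto intro!: derivative_eq_intros)

lemma sphere_param_polar_deriv:
  "((\<lambda>\<theta>. sphere_param \<rho> \<theta> \<phi> $ i) has_real_derivative \<rho> * polar_frame \<theta> \<phi> $ i) (at \<theta>)"
proof -
  have "\<forall>i. ((\<lambda>\<theta>. sphere_param \<rho> \<theta> \<phi> $ i) has_real_derivative \<rho> * polar_frame \<theta> \<phi> $ i) (at \<theta>)"
    unfolding forall_3 sphere_param_def polar_frame_def
    by (auto intro!: derivative_eq_intros)
  then show ?thesis by blast
qed

lemma sphere_param_azimuthal_deriv:
  "((\<lambda>\<phi>. sphere_param \<rho> \<theta> \<phi> $ i) has_real_derivative \<rho> * sin \<theta> * azimuthal_frame \<phi> $ i) (at \<phi>)"
proof -
  have "\<forall>i. ((\<lambda>\<phi>. sphere_param \<rho> \<theta> \<phi> $ i) has_real_derivative \<rho> * sin \<theta> * azimuthal_frame \<phi> $ i) (at \<phi>)"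
    unfolding forall_3 sphere_param_def azimuthal_frame_def
    by (auto intro!: derivative_eq_intros)
  then show ?thesis by blast
qed

lemma polar_frame_deriv:
  "((\<lambda>\<theta>. polar_frame \<theta> \<phi> $ i) has_real_derivative - sphere_param 1 \<theta> \<phi> $ i) (at \<theta>)"
proof -
  have "\<forall>i. ((\<lambda>\<theta>. polar_frame \<theta> \<phi> $ i) has_real_derivative - sphere_param 1 \<theta> \<phi> $ i) (at \<theta>)"
    unfolding forall_3 sphere_param_def polar_frame_def
    by (auto intro!: derivative_eq_intros)
  then show ?thesis by blast
qed

text \<open>The bracket is the horizontal unit vector (cos \<phi>, sin \<phi>, 0), whatever \<theta>
  is. Written in the frame, its cos \<theta> part cancels a term of the polar derivative in
  \<open>sphere_flux_deriv\<close>.\<close>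

lemma azimuthal_frame_deriv:
  "((\<lambda>\<phi>. azimuthal_frame \<phi> $ i) has_real_derivative
    - (sin \<theta> * sphere_param 1 \<theta> \<phi> $ i + cos \<theta> * polar_frame \<theta> \<phi> $ i)) (at \<phi>)"
proof -
  have "sin \<theta> * (sin \<theta> * z) + cos \<theta> * (cos \<theta> * z) = z" for z
    by (simp flip: mult.assoc distrib_right power2_eq_square)
  then have "\<forall>i. ((\<lambda>\<phi>. azimuthal_frame \<phi> $ i) has_real_derivative
      - (sin \<theta> * sphere_param 1 \<theta> \<phi> $ i + cos \<theta> * polar_frame \<theta> \<phi> $ i)) (at \<phi>)"
    unfolding forall_3 sphere_param_def polar_frame_def azimuthal_frame_def
    by (auto intro!: derivative_eq_intros)
  then show ?thesis by blast
qed

lemma frame_orthonormal: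
  "sphere_param 1 \<theta> \<phi> $ i * sphere_param 1 \<theta> \<phi> $ j + polar_frame \<theta> \<phi> $ i * polar_frame \<theta> \<phi> $ j
    + azimuthal_frame \<phi> $ i * azimuthal_frame \<phi> $ j = of_bool (i = j)"
proof -
  have s: "sin t * sin t = 1 - cos t * cos t" "sin t * (sin t * z) = (1 - cos t * cos t) * z" for t z :: real
    using sin_cos_squared_add[of t] by (simp_all add: power2_eq_square flip: mult.assoc)
  have "\<forall>i j. sphere_param 1 \<theta> \<phi> $ i * sphere_param 1 \<theta> \<phi> $ j + polar_frame \<theta> \<phi> $ i * polar_frame \<theta> \<phi> $ j
    + azimuthal_frame \<phi> $ i * azimuthal_frame \<phi> $ j = of_bool (i = j)"
    unfolding forall_3 sphere_param_def polar_frame_def azimuthal_frame_def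
    by (simp add: s algebra_simps)
  then show ?thesis by blast
qed

lemma continuous_sphere_param:
  fixes S :: "'a::t2_space set"
  assumes "continuous_on S r" "continuous_on S t" "continuous_on S p"
  shows "continuous_on S (\<lambda>x. sphere_param (r x) (t x) (p x))"
proof -
  have "\<forall>i. continuous_on S (\<lambda>x. sphere_param (r x) (t x) (p x) $ i)"
    unfolding forall_3 sphere_param_def using assms by (auto intro!: continuous_intros)
  then show ?thesis
    using continuous_on_vec_lambda[of S "\<lambda>i x. sphere_param (r x) (t x) (p x) $ i"] by simp
qed

lemma continuous_polar_frame:
  fixes S :: "'a::t2_space set"
  assumes "continuous_on S t" "continuous_on S p"
  shows "continuous_on S (\<lambda>x. polar_frame (t x) (p x) $ i)"
proof -
  have "\<forall>i. continuous_on S (\<lambda>x. polar_frame (t x) (p x) $ i)"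
    unfolding forall_3 polar_frame_def using assms by (auto intro!: continuous_intros)
  then show ?thesis by blast
qed

lemma continuous_azimuthal_frame:
  fixes S :: "'a::t2_space set"
  assumes "continuous_on S p"
  shows "continuous_on S (\<lambda>x. azimuthal_frame (p x) $ i)"
proof -
  have "\<forall>i. continuous_on S (\<lambda>x. azimuthal_frame (p x) $ i)"
    unfolding forall_3 azimuthal_frame_def using assms by (auto intro!: continuous_intros)
  then show ?thesis by blast
qed

lemma integral_polar_derivative:
  fixes F F' :: "real \<Rightarrow> real \<Rightarrow> real"
  assumes "continuous_on (cbox (0, 0) (pi, 2 * pi)) (\<lambda>(\<theta>, \<phi>). F' \<theta> \<phi>)"
    and "\<And>\<theta> \<phi>. ((\<lambda>\<theta>. F \<theta> \<phi>) has_real_derivative F' \<theta> \<phi>) (at \<theta>)"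
    and "\<And>\<phi>. F pi \<phi> = F 0 \<phi>"
  shows "integral (cbox (0, 0) (pi, 2 * pi)) (\<lambda>(\<theta>, \<phi>). F' \<theta> \<phi>) = 0"
proof -
  have "((\<lambda>\<theta>. F' \<theta> \<phi>) has_integral 0) (cbox 0 pi)" for \<phi>
    using fundamental_theorem_of_calculus[of 0 pi "\<lambda>\<theta>. F \<theta> \<phi>" "\<lambda>\<theta>. F' \<theta> \<phi>"] assms(2,3)
    by (auto simp: has_real_derivative_iff_has_vector_derivative intro: has_vector_derivative_at_within)
  then have "integral (cbox 0 pi) (\<lambda>\<theta>. F' \<theta> \<phi>) = 0" for \<phi>
    by (rule integral_unique)
  then show ?thesis
    using integral_prod_continuous[OF assms(1)] integral_swap_continuous[OF assms(1)]
    by (simp del: cbox_interval)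
qed

lemma integral_azimuthal_derivative:
  fixes F F' :: "real \<Rightarrow> real \<Rightarrow> real"
  assumes "continuous_on (cbox (0, 0) (pi, 2 * pi)) (\<lambda>(\<theta>, \<phi>). F' \<theta> \<phi>)"
    and "\<And>\<theta> \<phi>. ((\<lambda>\<phi>. F \<theta> \<phi>) has_real_derivative F' \<theta> \<phi>) (at \<phi>)"
    and "\<And>\<theta>. F \<theta> (2 * pi) = F \<theta> 0"
  shows "integral (cbox (0, 0) (pi, 2 * pi)) (\<lambda>(\<theta>, \<phi>). F' \<theta> \<phi>) = 0"
proof -
  have "((\<lambda>\<phi>. F' \<theta> \<phi>) has_integral 0) (cbox 0 (2 * pi))" for \<theta>
    using fundamental_theorem_of_calculus[of 0 "2 * pi" "\<lambda>\<phi>. F \<theta> \<phi>" "\<lambda>\<phi>. F' \<theta> \<phi>"] assms(2,3)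
    by (auto simp: has_real_derivative_iff_has_vector_derivative intro: has_vector_derivative_at_within)
  then have "integral (cbox 0 (2 * pi)) (\<lambda>\<phi>. F' \<theta> \<phi>) = 0" for \<theta>
    by (rule integral_unique)
  then show ?thesis
    using integral_prod_continuous[OF assms(1)]
    by (simp del: cbox_interval)
qed

lemma sphere_integral_flux_eq:
  assumes "0 < \<rho>"
  shows "sphere_integral \<rho> (\<lambda>x. \<Sum>j\<in>UNIV. V j x * (x $ j / norm x))
    = integral (cbox (0, 0) (pi, 2 * pi))
       (\<lambda>(\<theta>, \<phi>). (\<Sum>j\<in>UNIV. V j (sphere_param \<rho> \<theta> \<phi>) * sphere_param 1 \<theta> \<phi> $ j) * (\<rho>\<^sup>2 * sin \<theta>))"
proof -
  have "sphere_param \<rho> \<theta> \<phi> $ j / norm (sphere_param \<rho> \<theta> \<phi>) = sphere_param 1 \<theta> \<phi> $ j" for \<theta> \<phi> j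
    using assms by (subst sphere_param_scale) (simp add: norm_sphere_param)
  then show ?thesis
    by (simp only: sphere_integral_def)
qed

text \<open>The divergence theorem in differentiated form, which suits a field given only outside a
  ball. With e_\<theta>, e_\<phi> the tangent frame, the \<rho>-derivative of \<rho>^2 sin \<theta>
  V.n equals \<rho>^2 sin \<theta> div V - \<rho> d_\<theta>(sin \<theta> V.e_\<theta>) - \<rho>
  d_\<phi>(V.e_\<phi>), and the two exact derivatives integrate to zero.\<close>

lemma sphere_flux_deriv:
  fixes V :: "3 \<Rightarrow> real^3 \<Rightarrow> real"
  assumes diff: "\<And>j x. 1 < norm x \<Longrightarrow> V j differentiable (at x)"
    and cont: "\<And>i j. continuous_on (- cball 0 1) (partial_deriv i (V j))"
    and "1 < \<rho>"
  shows "((\<lambda>\<rho>. sphere_integral \<rho> (\<lambda>x. \<Sum>j\<in>UNIV. V j x * (x $ j / norm x))) has_real_derivative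
    sphere_integral \<rho> (\<lambda>x. \<Sum>j\<in>UNIV. partial_deriv j (V j) x)) (at \<rho>)"
proof -
  let ?box = "cbox (0, 0) (pi, 2 * pi) :: (real \<times> real) set"
  let ?V = "\<lambda>j \<rho> \<theta> \<phi>. V j (sphere_param \<rho> \<theta> \<phi>)"
  let ?D = "\<lambda>i j \<rho> \<theta> \<phi>. partial_deriv i (V j) (sphere_param \<rho> \<theta> \<phi>)"
  let ?n = "\<lambda>j \<theta> \<phi>. sphere_param 1 \<theta> \<phi> $ j"
  let ?t = "\<lambda>j \<theta> \<phi>. polar_frame \<theta> \<phi> $ j"
  let ?p = "\<lambda>j \<phi>. azimuthal_frame \<phi> $ j"
  define f where "f = (\<lambda>\<rho> \<theta> \<phi>. (\<Sum>j\<in>UNIV. ?V j \<rho> \<theta> \<phi> * ?n j \<theta> \<phi>) * (\<rho>\<^sup>2 * sin \<theta>))"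
  define f' where "f' = (\<lambda>\<rho> \<theta> \<phi>.
    (\<Sum>j\<in>UNIV. (\<Sum>i\<in>UNIV. ?n i \<theta> \<phi> * ?D i j \<rho> \<theta> \<phi>) * ?n j \<theta> \<phi>) * (\<rho>\<^sup>2 * sin \<theta>)
    + 2 * \<rho> * sin \<theta> * (\<Sum>j\<in>UNIV. ?V j \<rho> \<theta> \<phi> * ?n j \<theta> \<phi>))"
  \<comment> \<open>The factor sin \<theta> makes \<open>F\<close> vanish at both poles, while
    \<open>H\<close> below has period 2 pi in \<phi>; hence neither leaves a boundary term.\<close>
  define F where "F = (\<lambda>\<theta> \<phi>. \<Sum>j\<in>UNIV. ?V j \<rho> \<theta> \<phi> * (?t j \<theta> \<phi> * sin \<theta>))"
  define F' where "F' = (\<lambda>\<theta> \<phi>. \<Sum>j\<in>UNIV. (\<Sum>i\<in>UNIV. \<rho> * ?t i \<theta> \<phi> * ?D i j \<rho> \<theta> \<phi>) * (?t j \<theta> \<phi> * sin \<theta>)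
    + (- ?n j \<theta> \<phi> * sin \<theta> + cos \<theta> * ?t j \<theta> \<phi>) * ?V j \<rho> \<theta> \<phi>)"
  define H where "H = (\<lambda>\<theta> \<phi>. \<Sum>j\<in>UNIV. ?V j \<rho> \<theta> \<phi> * ?p j \<phi>)"
  define H' where "H' = (\<lambda>\<theta> \<phi>. \<Sum>j\<in>UNIV. (\<Sum>i\<in>UNIV. \<rho> * sin \<theta> * ?p i \<phi> * ?D i j \<rho> \<theta> \<phi>) * ?p j \<phi>
    + - (sin \<theta> * ?n j \<theta> \<phi> + cos \<theta> * ?t j \<theta> \<phi>) * ?V j \<rho> \<theta> \<phi>)"
  define dv where "dv = (\<lambda>\<theta> \<phi>. (\<Sum>j\<in>UNIV. ?D j j \<rho> \<theta> \<phi>) * (\<rho>\<^sup>2 * sin \<theta>))"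
  have ext: "1 < norm (sphere_param r \<theta> \<phi>)" if "1 < r" for r \<theta> \<phi>
    using that by (simp add: norm_sphere_param)
  have contV: "continuous_on (- cball 0 1) (V j)" for j
    by (rule continuous_at_imp_continuous_on) (auto simp: not_le intro!: differentiable_imp_continuous_within diff)
  have sub: "(\<lambda>x. sphere_param (r x) (a x) (b x)) ` S \<subseteq> - cball 0 1"
    if "\<And>x. x \<in> S \<Longrightarrow> 1 < r x" for S :: "'b::t2_space set" and r a b
    using that by (auto simp: norm_sphere_param dest!: that)
  have cV: "continuous_on S (\<lambda>x. ?V j (r x) (a x) (b x))"
    if "continuous_on S r" "continuous_on S a" "continuous_on S b" "\<And>x. x \<in> S \<Longrightarrow> 1 < r x"
    for S :: "'b::t2_space set" and r a b j
    by (rule continuous_on_compose2[OF contV]; intro continuous_sphere_param sub that)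
  have cD: "continuous_on S (\<lambda>x. ?D i j (r x) (a x) (b x))"
    if "continuous_on S r" "continuous_on S a" "continuous_on S b" "\<And>x. x \<in> S \<Longrightarrow> 1 < r x"
    for S :: "'b::t2_space set" and r a b i j
    by (rule continuous_on_compose2[OF cont]; intro continuous_sphere_param sub that)
  have cn: "continuous_on S (\<lambda>x. ?n j (a x) (b x))"
    if "continuous_on S a" "continuous_on S b" for S :: "'b::t2_space set" and a b j
    using that by (intro continuous_intros continuous_sphere_param) auto
  have deriv: "((\<lambda>\<rho>. f \<rho> \<theta> \<phi>) has_real_derivative f' r \<theta> \<phi>) (at r)" if "1 < r" for r \<theta> \<phi>
  proof -
    have "((\<lambda>\<rho>. f \<rho> \<theta> \<phi>) has_real_derivative
       (\<Sum>j\<in>UNIV. (\<Sum>i\<in>UNIV. ?n i \<theta> \<phi> * ?D i j r \<theta> \<phi>) * ?n j \<theta> \<phi>) * (r\<^sup>2 * sin \<theta>)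
       + (2 * r * sin \<theta>) * (\<Sum>j\<in>UNIV. ?V j r \<theta> \<phi> * ?n j \<theta> \<phi>)) (at r)"
      unfolding f_def
      by (intro DERIV_mult DERIV_sum DERIV_cmult_right has_real_derivative_chain diff ext that
          sphere_param_radial_deriv) (auto intro!: derivative_eq_intros)
    then show ?thesis by (simp add: f'_def)
  qed
  have Fd: "((\<lambda>\<theta>. F \<theta> \<phi>) has_real_derivative F' \<theta> \<phi>) (at \<theta>)" for \<theta> \<phi>
    unfolding F_def F'_def
    by (intro DERIV_sum DERIV_mult has_real_derivative_chain diff ext \<open>1 < \<rho>\<close>
        sphere_param_polar_deriv polar_frame_deriv DERIV_sin)
  have Hd: "((\<lambda>\<phi>. H \<theta> \<phi>) has_real_derivative H' \<theta> \<phi>) (at \<phi>)" for \<theta> \<phi>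
    unfolding H_def H'_def
    by (intro DERIV_sum DERIV_mult has_real_derivative_chain diff ext \<open>1 < \<rho>\<close>
        sphere_param_azimuthal_deriv azimuthal_frame_deriv)
  \<comment> \<open>Each of \<open>F'\<close> and \<open>H'\<close> contains - sin \<theta> V.n;
    together these account for the term 2 \<rho> sin \<theta> V.n in \<open>f'\<close>. The second
    derivatives of position along e_\<theta> cancel, and orthonormality assembles the rest into the
    divergence.\<close>
  have split: "f' \<rho> \<theta> \<phi> = dv \<theta> \<phi> - \<rho> * F' \<theta> \<phi> - \<rho> * H' \<theta> \<phi>" for \<theta> \<phi>
  proof -
    have "dv \<theta> \<phi> = (\<Sum>j\<in>UNIV. \<Sum>i\<in>UNIV. of_bool (i = j) * ?D i j \<rho> \<theta> \<phi>) * (\<rho>\<^sup>2 * sin \<theta>)"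
      by (simp add: dv_def)
    also have "\<dots> = (\<Sum>j\<in>UNIV. (\<Sum>i\<in>UNIV. ?n i \<theta> \<phi> * ?D i j \<rho> \<theta> \<phi>) * ?n j \<theta> \<phi>
        + (\<Sum>i\<in>UNIV. ?t i \<theta> \<phi> * ?D i j \<rho> \<theta> \<phi>) * ?t j \<theta> \<phi>
        + (\<Sum>i\<in>UNIV. ?p i \<phi> * ?D i j \<rho> \<theta> \<phi>) * ?p j \<phi>) * (\<rho>\<^sup>2 * sin \<theta>)"
      unfolding frame_orthonormal[of \<theta> \<phi>, symmetric]
      by (simp only: sum_3) (simp add: algebra_simps)
    finally have dv: "dv \<theta> \<phi> = \<dots>" .
    show ?thesis
      unfolding dv f'_def F'_def H'_def sum_3 power2_eq_square
      by (simp add: algebra_simps)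
  qed
  have cF: "continuous_on ?box (\<lambda>(\<theta>, \<phi>). F' \<theta> \<phi>)" and cH: "continuous_on ?box (\<lambda>(\<theta>, \<phi>). H' \<theta> \<phi>)"
    and cd: "continuous_on ?box (\<lambda>(\<theta>, \<phi>). dv \<theta> \<phi>)"
    unfolding F'_def H'_def dv_def case_prod_beta
    by (intro continuous_intros cV cD cn continuous_polar_frame continuous_azimuthal_frame \<open>1 < \<rho>\<close>)+
  have "((\<lambda>\<rho>. integral ?box (\<lambda>(\<theta>, \<phi>). f \<rho> \<theta> \<phi>)) has_real_derivative
      integral ?box (\<lambda>(\<theta>, \<phi>). f' \<rho> \<theta> \<phi>)) (at \<rho> within {1<..})"
  proof (rule leibniz_rule_field_derivative)
    show "((\<lambda>\<rho>. case t of (\<theta>, \<phi>) \<Rightarrow> f \<rho> \<theta> \<phi>) has_real_derivative (case t of (\<theta>, \<phi>) \<Rightarrow> f' x \<theta> \<phi>)) (at x within {1<..})"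
      if "x \<in> {1<..}" for x t
      using deriv that by (cases t) (auto intro: has_field_derivative_at_within)
    show "(\<lambda>(\<theta>, \<phi>). f x \<theta> \<phi>) integrable_on ?box" if "x \<in> {1<..}" for x
      unfolding f_def case_prod_beta
      by (intro integrable_continuous continuous_intros cV cD cn) (use that in auto)
    show "continuous_on ({1<..} \<times> ?box) (\<lambda>(x, t). case t of (\<theta>, \<phi>) \<Rightarrow> f' x \<theta> \<phi>)"
      unfolding f'_def case_prod_beta
      by (intro continuous_intros cV cD cn) auto
  qed (use \<open>1 < \<rho>\<close> in auto)
  then have d: "((\<lambda>\<rho>. integral ?box (\<lambda>(\<theta>, \<phi>). f \<rho> \<theta> \<phi>)) has_real_derivative
      integral ?box (\<lambda>(\<theta>, \<phi>). f' \<rho> \<theta> \<phi>)) (at \<rho>)"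
    using at_within_open[of \<rho> "{1<..}"] \<open>1 < \<rho>\<close> by auto
  have "integral ?box (\<lambda>(\<theta>, \<phi>). f' \<rho> \<theta> \<phi>)
      = integral ?box (\<lambda>(\<theta>, \<phi>). dv \<theta> \<phi>) - \<rho> * integral ?box (\<lambda>(\<theta>, \<phi>). F' \<theta> \<phi>)
        - \<rho> * integral ?box (\<lambda>(\<theta>, \<phi>). H' \<theta> \<phi>)"
  proof (rule integral_unique)
    have "((\<lambda>x. (case x of (\<theta>, \<phi>) \<Rightarrow> dv \<theta> \<phi>) - \<rho> * (case x of (\<theta>, \<phi>) \<Rightarrow> F' \<theta> \<phi>) - \<rho> * (case x of (\<theta>, \<phi>) \<Rightarrow> H' \<theta> \<phi>))
        has_integral (integral ?box (\<lambda>(\<theta>, \<phi>). dv \<theta> \<phi>) - \<rho> * integral ?box (\<lambda>(\<theta>, \<phi>). F' \<theta> \<phi>)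
        - \<rho> * integral ?box (\<lambda>(\<theta>, \<phi>). H' \<theta> \<phi>))) ?box"
      by (intro has_integral_diff has_integral_mult_right integrable_integral integrable_continuous cF cH cd)
    then show "((\<lambda>(\<theta>, \<phi>). f' \<rho> \<theta> \<phi>) has_integral (integral ?box (\<lambda>(\<theta>, \<phi>). dv \<theta> \<phi>)
        - \<rho> * integral ?box (\<lambda>(\<theta>, \<phi>). F' \<theta> \<phi>) - \<rho> * integral ?box (\<lambda>(\<theta>, \<phi>). H' \<theta> \<phi>))) ?box"
      unfolding split case_prod_unfold .
  qed
  also have "integral ?box (\<lambda>(\<theta>, \<phi>). F' \<theta> \<phi>) = 0"
    by (rule integral_polar_derivative[OF cF Fd]) (simp add: F_def)
  also have "integral ?box (\<lambda>(\<theta>, \<phi>). H' \<theta> \<phi>) = 0"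
    by (rule integral_azimuthal_derivative[OF cH Hd])
      (simp add: H_def sphere_param_def azimuthal_frame_def)
  finally have "integral ?box (\<lambda>(\<theta>, \<phi>). f' \<rho> \<theta> \<phi>) = sphere_integral \<rho> (\<lambda>x. \<Sum>j\<in>UNIV. partial_deriv j (V j) x)"
    by (simp add: sphere_integral_def dv_def)
  with d have d: "((\<lambda>\<rho>. integral ?box (\<lambda>(\<theta>, \<phi>). f \<rho> \<theta> \<phi>)) has_real_derivative
      sphere_integral \<rho> (\<lambda>x. \<Sum>j\<in>UNIV. partial_deriv j (V j) x)) (at \<rho>)"
    by simp
  have e: "integral ?box (\<lambda>(\<theta>, \<phi>). f r \<theta> \<phi>) = sphere_integral r (\<lambda>x. \<Sum>j\<in>UNIV. V j x * (x $ j / norm x))"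
    if "r \<in> {1<..}" for r
    unfolding f_def by (rule sphere_integral_flux_eq[symmetric]) (use that in simp)
  show ?thesis
    by (rule has_field_derivative_transform_within_open[OF d open_greaterThan _ e])
      (use \<open>1 < \<rho>\<close> in simp_all)
qed

section \<open>Divergence of the center of mass\<close>

lemma sphere_integral_cong:
  assumes "0 < \<rho>" "\<And>x. norm x = \<rho> \<Longrightarrow> f x = g x"
  shows "sphere_integral \<rho> f = sphere_integral \<rho> g"
  using assms by (simp add: sphere_integral_def norm_sphere_param)

text \<open>The constant 2 pi^2 is the area of the parameter rectangle, with |sin \<theta>| \<le> 1;
  it is cruder than 4 pi, but only the power of \<rho> matters.\<close>

lemma sphere_integral_bound:
  assumes "0 < \<rho>" "0 \<le> B" and B: "\<And>x. norm x = \<rho> \<Longrightarrow> \<bar>f x\<bar> \<le> B"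
  shows "\<bar>sphere_integral \<rho> f\<bar> \<le> 2 * pi\<^sup>2 * B * \<rho>\<^sup>2"
proof (cases "(\<lambda>(\<theta>, \<phi>). f (sphere_param \<rho> \<theta> \<phi>) * (\<rho>\<^sup>2 * sin \<theta>)) integrable_on cbox (0, 0) (pi, 2 * pi)")
  case True
  have "\<bar>f (sphere_param \<rho> \<theta> \<phi>) * (\<rho>\<^sup>2 * sin \<theta>)\<bar> \<le> B * (\<rho>\<^sup>2 * 1)" for \<theta> \<phi>
    unfolding abs_mult
    using assms by (intro mult_mono B) (auto simp: norm_sphere_param)
  then have "norm (sphere_integral \<rho> f) \<le> (B * \<rho>\<^sup>2) * measure lborel (cbox (0, 0) (pi, 2 * pi) :: (real \<times> real) set)"
    unfolding sphere_integral_def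
    by (intro has_integral_bound[OF _ integrable_integral[OF True]]) (use \<open>0 \<le> B\<close> in auto)
  also have "measure lborel (cbox (0, 0) (pi, 2 * pi) :: (real \<times> real) set) = 2 * pi\<^sup>2"
    by (simp add: content_Pair power2_eq_square)
  finally show ?thesis by (simp add: algebra_simps)
next
  \<comment> \<open>\<open>integral\<close> is 0 for a function that is not integrable, so the bound
    holds in this case too.\<close>
  case False
  then show ?thesis
    using assms by (simp add: sphere_integral_def not_integrable_integral)
qed

lemma sphere_integrable:
  assumes "0 < \<rho>" "continuous_on (sphere 0 \<rho>) f"
  shows "(\<lambda>(\<theta>, \<phi>). f (sphere_param \<rho> \<theta> \<phi>) * (\<rho>\<^sup>2 * sin \<theta>)) integrable_on cbox (0, 0) (pi, 2 * pi)"
  unfolding case_prod_beta using assms(1)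
  by (intro integrable_continuous continuous_intros continuous_on_compose2[OF assms(2)] continuous_sphere_param)
    (auto simp: norm_sphere_param)

lemma sphere_integral_diff:
  assumes "0 < \<rho>" "continuous_on (sphere 0 \<rho>) f" "continuous_on (sphere 0 \<rho>) g"
  shows "sphere_integral \<rho> (\<lambda>x. f x - g x) = sphere_integral \<rho> f - sphere_integral \<rho> g"
  unfolding sphere_integral_def
  using integral_diff[OF sphere_integrable[OF assms(1,2)] sphere_integrable[OF assms(1,3)]]
  by (simp add: case_prod_unfold left_diff_distrib)

lemma integral_by_antiderivative:
  assumes "a \<le> b" "\<And>x. (F has_real_derivative f x) (at x)"
  shows "integral (cbox a b) f = F b - F a"
  using fundamental_theorem_of_calculus[of a b F f] assms
  by (intro integral_unique)
    (auto simp: has_real_derivative_iff_has_vector_derivative intro: has_vector_derivative_at_within)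

lemma sin_sin_real: "sin x * (sin x :: real) = 1 - cos x * cos x" "sin x * (sin x * z) = (1 - cos x * cos x) * z" for x z :: real
  using sin_cos_squared_add[of x] by (simp_all add: power2_eq_square flip: mult.assoc)

text \<open>Odd moments of n_1 vanish and n_1^2 has mean 1/3. Degree three suffices, as the largest
  integrand is n_1 times the quadratic polynomial of \<open>scal_quad_jet\<close>.\<close>

lemma sphere_integral_cubic:
  assumes "0 < \<rho>"
  shows "sphere_integral \<rho> (\<lambda>x. a + b * (x /\<^sub>R norm x)$1 + c * (x /\<^sub>R norm x)$1 ^ 2 + d * (x /\<^sub>R norm x)$1 ^ 3)
    = 4 * pi * \<rho>\<^sup>2 * (a + c / 3)"
proof -
  have n: "(sphere_param \<rho> \<theta> \<phi> /\<^sub>R norm (sphere_param \<rho> \<theta> \<phi>)) $ 1 = sin \<theta> * cos \<phi>" for \<theta> \<phi>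
    using assms by (simp add: norm_sphere_param) (simp add: sphere_param_def)
  let ?f = "\<lambda>\<theta> \<phi>. (a + b * (sin \<theta> * cos \<phi>) + c * (sin \<theta> * cos \<phi>)^2 + d * (sin \<theta> * cos \<phi>)^3) * (\<rho>\<^sup>2 * sin \<theta>)"
  have inner: "integral (cbox 0 (2 * pi)) (\<lambda>\<phi>. ?f \<theta> \<phi>) = (2 * pi * a + c * pi * (sin \<theta>)^2) * (\<rho>\<^sup>2 * sin \<theta>)" for \<theta>
  proof -
    let ?F = "\<lambda>\<phi>. (a * \<phi> + b * sin \<theta> * sin \<phi> + c * (sin \<theta>)^2 * ((\<phi> + sin \<phi> * cos \<phi>) / 2)
      + d * (sin \<theta>)^3 * (sin \<phi> - (sin \<phi>)^3 / 3)) * (\<rho>\<^sup>2 * sin \<theta>)"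
    have "(?F has_real_derivative ?f \<theta> \<phi>) (at \<phi>)" for \<phi>
    proof -
      have d1: "((\<lambda>\<phi>. (\<phi> + sin \<phi> * cos \<phi>) / 2) has_real_derivative (cos \<phi>)^2) (at \<phi>)"
        by (auto intro!: derivative_eq_intros simp: sin_sin_real power2_eq_square field_simps)
      have d2: "((\<lambda>\<phi>. sin \<phi> - (sin \<phi>)^3 / 3) has_real_derivative (cos \<phi>)^3) (at \<phi>)"
        by (auto intro!: derivative_eq_intros simp: sin_sin_real power2_eq_square power3_eq_cube field_simps)
      show ?thesis
        by (rule DERIV_cong, (rule d1 d2 DERIV_add DERIV_cmult DERIV_cmult_right DERIV_ident DERIV_sin)+)
          (simp add: power_mult_distrib algebra_simps)
    qed
    then have "integral (cbox 0 (2 * pi)) (\<lambda>\<phi>. ?f \<theta> \<phi>) = ?F (2 * pi) - ?F 0"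
      by (intro integral_by_antiderivative) auto
    then show ?thesis
      by (simp add: algebra_simps)
  qed
  have outer: "integral (cbox 0 pi) (\<lambda>\<theta>. (2 * pi * a + c * pi * (sin \<theta>)^2) * (\<rho>\<^sup>2 * sin \<theta>)) = 4 * pi * \<rho>\<^sup>2 * (a + c / 3)"
  proof -
    let ?F = "\<lambda>\<theta>. (- 2 * pi * a * cos \<theta> + c * pi * ((cos \<theta>)^3 / 3 - cos \<theta>)) * \<rho>\<^sup>2"
    have "(?F has_real_derivative (2 * pi * a + c * pi * (sin \<theta>)^2) * (\<rho>\<^sup>2 * sin \<theta>)) (at \<theta>)" for \<theta>
    proof -
      have d: "((\<lambda>\<theta>. (cos \<theta>)^3 / 3 - cos \<theta>) has_real_derivative (sin \<theta>)^2 * sin \<theta>) (at \<theta>)"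
        by (auto intro!: derivative_eq_intros simp: sin_sin_real power2_eq_square power3_eq_cube field_simps)
      show ?thesis
        by (rule DERIV_cong, (rule d DERIV_add DERIV_cmult DERIV_cmult_right DERIV_cos)+)
          (simp add: algebra_simps)
    qed
    then have "integral (cbox 0 pi) (\<lambda>\<theta>. (2 * pi * a + c * pi * (sin \<theta>)^2) * (\<rho>\<^sup>2 * sin \<theta>)) = ?F pi - ?F 0"
      by (intro integral_by_antiderivative) auto
    then show ?thesis
      by (simp add: field_simps)
  qed
  have cont: "continuous_on (cbox (0, 0) (pi, 2 * pi)) (\<lambda>(\<theta>, \<phi>). ?f \<theta> \<phi>)"
    unfolding case_prod_beta by (intro continuous_intros)
  have "sphere_integral \<rho> (\<lambda>x. a + b * (x /\<^sub>R norm x)$1 + c * (x /\<^sub>R norm x)$1 ^ 2 + d * (x /\<^sub>R norm x)$1 ^ 3)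
      = integral (cbox (0, 0) (pi, 2 * pi)) (\<lambda>(\<theta>, \<phi>). ?f \<theta> \<phi>)"
    by (simp only: sphere_integral_def n)
  also have "\<dots> = integral (cbox 0 pi) (\<lambda>\<theta>. integral (cbox 0 (2 * pi)) (\<lambda>\<phi>. ?f \<theta> \<phi>))"
    using integral_prod_continuous[OF cont] by (simp only: prod.case)
  finally show ?thesis
    by (simp only: inner outer)
qed

text \<open>Eventually the error is below half of |c| / \<rho>. After multiplication by - sgn c,
  which makes the growth positive, the other half survives, so |f| dominates a constant plus (|c| /
  2) ln \<rho>.\<close>

lemma logarithmic_divergence:
  fixes f f' :: "real \<Rightarrow> real"
  assumes deriv: "\<And>\<rho>. r0 < \<rho> \<Longrightarrow> (f has_real_derivative f' \<rho>) (at \<rho>)"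
    and bound: "\<And>\<rho>. r0 < \<rho> \<Longrightarrow> \<bar>f' \<rho> + c / \<rho>\<bar> \<le> C * \<rho> powr (- 1 - q)"
    and "c \<noteq> 0" "0 < q"
  shows "filterlim (\<lambda>\<rho>. \<bar>f \<rho>\<bar>) at_top at_top"
proof -
  have "((\<lambda>\<rho>. C * \<rho> powr (- q)) \<longlongrightarrow> C * 0) at_top"
    using \<open>0 < q\<close> by (intro tendsto_intros tendsto_neg_powr filterlim_ident) auto
  then have "\<forall>\<^sub>F \<rho> in at_top. C * \<rho> powr (- q) < \<bar>c\<bar> / 2"
    using \<open>c \<noteq> 0\<close> by (intro order_tendstoD(2)) auto
  then obtain R0 where R0: "\<And>\<rho>. R0 \<le> \<rho> \<Longrightarrow> C * \<rho> powr (- q) < \<bar>c\<bar> / 2"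
    unfolding eventually_at_top_linorder by blast
  define R where "R = max R0 (max (r0 + 1) 1)"
  define h where "h = (\<lambda>\<rho>. - sgn c * f \<rho> - \<bar>c\<bar> / 2 * ln \<rho>)"
  have mono: "h R \<le> h \<rho>" if "R \<le> \<rho>" for \<rho>
  proof (rule DERIV_nonneg_imp_nondecreasing[OF that])
    fix x assume "R \<le> x" "x \<le> \<rho>"
    then have x: "R0 \<le> x" "r0 < x" "0 < x"
      by (auto simp: R_def)
    have "\<bar>f' x + c / x\<bar> \<le> C * x powr (- q) / x"
      using bound[OF x(2)] x(3) by (simp add: powr_diff powr_minus field_simps)
    also have "\<dots> \<le> \<bar>c\<bar> / 2 / x"
      using R0[OF x(1)] x(3) by (intro divide_right_mono) auto
    finally have "\<bar>f' x + c / x\<bar> \<le> \<bar>c\<bar> / 2 / x" .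
    then have "\<bar>sgn c * (f' x + c / x)\<bar> \<le> \<bar>c\<bar> / 2 / x"
      using \<open>c \<noteq> 0\<close> by (simp add: abs_mult)
    moreover have "sgn c * (f' x + c / x) = sgn c * f' x + \<bar>c\<bar> / x"
      by (simp add: distrib_left sgn_mult_self_eq abs_sgn mult.commute)
    ultimately have "0 \<le> - sgn c * f' x - \<bar>c\<bar> / 2 * (1 / x)"
      by (simp add: abs_le_iff field_simps)
    moreover have "(h has_real_derivative - sgn c * f' x - \<bar>c\<bar> / 2 * (1 / x)) (at x)"
      unfolding h_def using x deriv[OF x(2)]
      by (auto intro!: derivative_eq_intros simp: field_simps)
    ultimately show "\<exists>y. (h has_real_derivative y) (at x) \<and> 0 \<le> y"
      by blast
  qed
  have "filterlim (\<lambda>\<rho>. h R + \<bar>c\<bar> / 2 * ln \<rho>) at_top at_top"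
    using \<open>c \<noteq> 0\<close>
    by (intro filterlim_tendsto_add_at_top[OF tendsto_const]
        filterlim_tendsto_pos_mult_at_top[OF tendsto_const _ ln_at_top]) auto
  then show ?thesis
  proof (rule filterlim_at_top_mono)
    have "h R + \<bar>c\<bar> / 2 * ln \<rho> \<le> \<bar>f \<rho>\<bar>" if "R \<le> \<rho>" for \<rho>
    proof -
      have "h R + \<bar>c\<bar> / 2 * ln \<rho> \<le> - sgn c * f \<rho>"
        using mono[OF that] by (simp add: h_def)
      also have "\<dots> \<le> \<bar>- sgn c * f \<rho>\<bar>" by (rule abs_ge_self)
      also have "\<dots> = \<bar>f \<rho>\<bar>" using \<open>c \<noteq> 0\<close> by (simp add: abs_mult)
      finally show ?thesis .
    qed
    then show "\<forall>\<^sub>F \<rho> in at_top. h R + \<bar>c\<bar> / 2 * ln \<rho> \<le> \<bar>f \<rho>\<bar>"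
      unfolding eventually_at_top_linorder by blast
  qed
qed

section \<open>Center of mass flux and energy of the metric\<close>

context asymptotic_metric
begin

definition center_field :: "3 \<Rightarrow> real^3 \<Rightarrow> real" where
  "center_field j x = x$1 * (\<Sum>i\<in>UNIV. dmet g i i j x - dmet g j i i x)
    - (g x $ j $ 1 - of_bool (j = 1) * (\<Sum>i\<in>UNIV. g x $ i $ i))"

lemma center_integral_flux:
  "center_integral g 1 \<rho> = sphere_integral \<rho> (\<lambda>x. \<Sum>j\<in>UNIV. center_field j x * (x $ j / norm x))"
proof -
  have "x $ 1 * mass_density g x - (\<Sum>i\<in>UNIV. g x $ i $ 1 * (x $ i / norm x) - g x $ i $ i * (x $ 1 / norm x))
    = (\<Sum>j\<in>UNIV. center_field j x * (x $ j / norm x))" for x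
    unfolding mass_density_def center_field_def sum_3
    by (simp add: algebra_simps)
  then show ?thesis
    by (simp add: center_integral_def)
qed

lemma center_field_partial:
  assumes "1 < norm x"
  shows "partial_deriv m (center_field j) x =
    of_bool (1 = m) * (\<Sum>i\<in>UNIV. dmet g i i j x - dmet g j i i x)
    + x$1 * (\<Sum>i\<in>UNIV. ddmet g m i i j x - ddmet g m j i i x)
    - (dmet g m j 1 x - of_bool (j = 1) * (\<Sum>i\<in>UNIV. dmet g m i i x))"
  unfolding center_field_def[abs_def]
  by (intro has_partial_imp_partial_deriv has_partial_diff has_partial_mult has_partial_cmult
      has_partial_sum has_partial_component has_partial_g has_partial_dmet assms)

lemma center_field_differentiable: "1 < norm x \<Longrightarrow> center_field j differentiable (at x)"
  unfolding center_field_def[abs_def]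
  by (intro differentiable_diff differentiable_mult differentiable_sum ballI differentiable_const
      bounded_linear_imp_differentiable[OF bounded_linear_vec_nth] g_differentiable dmet_differentiable)
    simp_all

lemma dmet_continuous: "continuous_on (- cball 0 1) (dmet g k i j)"
  by (rule continuous_at_imp_continuous_on)
    (auto simp: not_le intro!: differentiable_imp_continuous_within dmet_differentiable)

lemma center_field_C1: "continuous_on (- cball 0 1) (partial_deriv m (center_field j))"
proof -
  have "continuous_on (- cball 0 1) (\<lambda>x. of_bool (1 = m) * (\<Sum>i\<in>UNIV. dmet g i i j x - dmet g j i i x)
    + x$1 * (\<Sum>i\<in>UNIV. ddmet g m i i j x - ddmet g m j i i x)
    - (dmet g m j 1 x - of_bool (j = 1) * (\<Sum>i\<in>UNIV. dmet g m i i x)))"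
    by (intro continuous_intros dmet_continuous ddmet_continuous)
  then show ?thesis
    by (rule continuous_on_eq) (simp add: center_field_partial not_le)
qed

text \<open>Differentiating the factor x_1 leaves the first-order terms g_i1,i - g_ii,1, summed over
  i; the divergence of the undifferentiated part of the field cancels exactly these.\<close>

lemma center_field_divergence:
  assumes "1 < norm x"
  shows "(\<Sum>j\<in>UNIV. partial_deriv j (center_field j) x) = x$1 * curv_lin x"
  unfolding center_field_partial[OF assms] curv_lin_def sum_3
  by (simp add: algebra_simps)

lemma center_integral_deriv:
  assumes "1 < \<rho>"
  shows "(center_integral g 1 has_real_derivative sphere_integral \<rho> (\<lambda>x. x$1 * curv_lin x)) (at \<rho>)"
proof -
  have "sphere_integral \<rho> (\<lambda>x. \<Sum>j\<in>UNIV. partial_deriv j (center_field j) x)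
      = sphere_integral \<rho> (\<lambda>x. x$1 * curv_lin x)"
    using assms by (intro sphere_integral_cong center_field_divergence) auto
  then show ?thesis
    using sphere_flux_deriv[of center_field, OF center_field_differentiable center_field_C1 assms]
    by (simp add: center_integral_flux[abs_def])
qed

lemma continuous_curv_lin: "continuous_on (- cball 0 1) curv_lin"
  unfolding curv_lin_def[abs_def] by (intro continuous_intros ddmet_continuous)

lemma center_integral_deriv_asymptotics:
  assumes flat: "\<And>x. 1 < norm x \<Longrightarrow> scalar_curvature g x = 0"
  obtains C r0 where "1 \<le> r0" "\<And>\<rho>. r0 < \<rho> \<Longrightarrow>
    \<bar>sphere_integral \<rho> (\<lambda>x. x$1 * curv_lin x) + 2 * pi * A / \<rho>\<bar> \<le> C * \<rho> powr (- 1 - q)"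
proof -
  let ?n = "\<lambda>x::real^3. (x /\<^sub>R norm x)$1"
  let ?q = "\<lambda>x. (3/2 * A\<^sup>2 + 3/8 + 3/2 * A * ?n x - ?n x * ?n x / 2)"
  obtain C r1 where C: "\<And>x. r1 < norm x \<Longrightarrow>
      \<bar>curv_lin x + ?q x * inverse (norm x)^4\<bar> \<le> C * norm x powr (- (4 + q))"
    using curv_lin_approx[OF flat] unfolding decays_iff by blast
  show thesis
  proof (rule that[of "max 1 r1" "2 * pi\<^sup>2 * C"])
    fix \<rho> :: real assume "max 1 r1 < \<rho>"
    then have \<rho>: "1 < \<rho>" "r1 < \<rho>" "0 < \<rho>" by auto
    \<comment> \<open>One factor \<rho> comes from x_1 = \<rho> n_1 and \<rho>^(-4) from the
      quadratic curvature. The summand 0 in \<open>?m\<close> fits it to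
      \<open>sphere_integral_cubic\<close>.\<close>
    define w where "w = 1 / \<rho>^3"
    let ?m = "\<lambda>x. 0 + - (3/2 * A\<^sup>2 + 3/8) * w * ?n x + - (3/2 * A) * w * ?n x ^ 2 + w / 2 * ?n x ^ 3"
    have m: "x$1 * (?q x * inverse (norm x)^4) = - ?m x" if "norm x = \<rho>" for x
    proof -
      have "x$1 = \<rho> * ?n x"
        using \<rho>(3) by (simp add: that right_inverse flip: mult.assoc)
      then have "x$1 * (?q x * inverse (norm x)^4) = (\<rho> * ?n x) * (?q x * inverse (norm x)^4)"
        by (rule arg_cong[of _ _ "\<lambda>u. u * (?q x * inverse (norm x)^4)"])
      also have "\<dots> = ?n x * ?q x * (\<rho> * inverse \<rho>^4)"
        by (simp only: that mult_ac)
      also have "\<rho> * inverse \<rho>^4 = w"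
        using \<rho> by (simp add: w_def field_simps eval_nat_numeral)
      finally have "x$1 * (?q x * inverse (norm x)^4) = ?n x * ?q x * w" .
      moreover have "u * (3/2 * A\<^sup>2 + 3/8 + 3/2 * A * u - u * u / 2) * w
          = - (0 + - (3/2 * A\<^sup>2 + 3/8) * w * u + - (3/2 * A) * w * u ^ 2 + w / 2 * u ^ 3)" for u
        by (simp add: algebra_simps power2_eq_square power3_eq_cube)
      ultimately show ?thesis
        by (simp only:)
    qed
    \<comment> \<open>Only the n_1^2 coefficient counts: 4 pi \<rho>^2 (- 3/2 A \<rho>^(-3)) /
      3.\<close>
    have I1: "sphere_integral \<rho> ?m = - 2 * pi * A / \<rho>"
      unfolding sphere_integral_cubic[OF \<rho>(3)] w_def using \<rho>
      by (simp add: field_simps eval_nat_numeral)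
    have I2: "sphere_integral \<rho> (\<lambda>x. x$1 * curv_lin x - ?m x)
        = sphere_integral \<rho> (\<lambda>x. x$1 * curv_lin x) - sphere_integral \<rho> ?m"
    proof (rule sphere_integral_diff[OF \<rho>(3)])
      have "sphere 0 \<rho> \<subseteq> - cball (0::real^3) 1" "\<forall>x\<in>sphere 0 \<rho>. norm (x::real^3) \<noteq> 0"
        using \<rho> by auto
      then show "continuous_on (sphere 0 \<rho>) (\<lambda>x. x$1 * curv_lin x)" "continuous_on (sphere 0 \<rho>) ?m"
        using continuous_on_subset[OF continuous_curv_lin] by (auto intro!: continuous_intros)
    qed
    have I3: "\<bar>sphere_integral \<rho> (\<lambda>x. x$1 * curv_lin x - ?m x)\<bar>
        \<le> 2 * pi\<^sup>2 * (\<rho> * (C * \<rho> powr (- (4 + q)))) * \<rho>\<^sup>2"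
    proof (rule sphere_integral_bound[OF \<rho>(3)])
      show "\<bar>x$1 * curv_lin x - ?m x\<bar> \<le> \<rho> * (C * \<rho> powr (- (4 + q)))" if "norm x = \<rho>" for x
      proof -
        have "x$1 * curv_lin x - ?m x = x$1 * (curv_lin x + ?q x * inverse (norm x)^4)"
          using m[OF that] by (simp add: distrib_left)
        then have "\<bar>x$1 * curv_lin x - ?m x\<bar> = \<bar>x$1\<bar> * \<bar>curv_lin x + ?q x * inverse (norm x)^4\<bar>"
          by (simp only: abs_mult)
        also have "\<dots> \<le> \<rho> * (C * \<rho> powr (- (4 + q)))"
          using that \<rho> component_le_norm_cart[of x 1] C[of x] by (intro mult_mono) auto
        finally show ?thesis .
      qed
      have x: "norm (\<rho> *\<^sub>R axis 1 1 :: real^3) = \<rho>"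
        using \<rho> by simp
      \<comment> \<open>The sign of \<open>C\<close> is not given; the bound at one point of the
        sphere forces its right-hand side to be nonnegative.\<close>
      have "0 \<le> C * \<rho> powr (- (4 + q))"
        by (rule order_trans[OF abs_ge_zero C[of "\<rho> *\<^sub>R axis 1 1", unfolded x, OF \<rho>(2)]])
      then show "0 \<le> \<rho> * (C * \<rho> powr (- (4 + q)))"
        by (rule mult_nonneg_nonneg[OF less_imp_le[OF \<rho>(3)]])
    qed
    have I4: "2 * pi\<^sup>2 * (\<rho> * (C * \<rho> powr (- (4 + q)))) * \<rho>\<^sup>2 = 2 * pi\<^sup>2 * C * \<rho> powr (- 1 - q)"
    proof -
      have "\<rho> powr (- (4 + q)) * \<rho> powr 3 = \<rho> powr (- 1 - q)"
        by (simp flip: powr_add)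
      moreover have "\<rho> powr 3 = \<rho> * \<rho>\<^sup>2"
        using \<rho> by (simp add: powr_numeral eval_nat_numeral)
      ultimately show ?thesis
        by (simp add: algebra_simps)
    qed
    show "\<bar>sphere_integral \<rho> (\<lambda>x. x$1 * curv_lin x) + 2 * pi * A / \<rho>\<bar>
        \<le> 2 * pi\<^sup>2 * C * \<rho> powr (- 1 - q)"
      using I3 unfolding I2 I1 I4 by simp
  qed auto
qed

lemma mass_density_approx:
  "decays (2 + q) (\<lambda>x. mass_density g x - ((x /\<^sub>R norm x)$1 + 2 * A) * inverse (norm x)^2)"
proof -
  have n: "decays 0 (\<lambda>x. x $ j / norm x)" for j
  proof -
    have "\<bar>x $ j / norm x\<bar> \<le> 1" for x :: "real^3"
      using component_le_norm_cart[of x j] by (cases "x = 0") auto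
    then show ?thesis
      unfolding decays_iff by (intro exI[of _ 1] exI[of _ 0]) auto
  qed
  have "decays (2 + q) (\<lambda>x. (dmet g i i j x - dmet g j i i x) - (mod1 i i j x - mod1 j i i x))" for i j
    using sum_in_bigo(2)[OF approx1[of i i j] approx1[of j i i]] by (simp add: algebra_simps)
  then have "decays (2 + q) (\<lambda>x. ((dmet g i i j x - dmet g j i i x) - (mod1 i i j x - mod1 j i i x)) * (x $ j / norm x))" for i j
    using decays_mult[where p = "2 + q", OF _ n[of j]] by simp
  then have "decays (2 + q) (\<lambda>x. \<Sum>i\<in>UNIV. \<Sum>j\<in>UNIV.
      ((dmet g i i j x - dmet g j i i x) - (mod1 i i j x - mod1 j i i x)) * (x $ j / norm x))"
    by (intro decays_sum)
  then show ?thesis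
  proof (rule decays_transform[of _ _ 0])
    fix x :: "real^3" assume "0 < norm x"
    define n where "n = x /\<^sub>R norm x"
    have n: "norm n = 1" "x $ j / norm x = n $ j" for j
      using \<open>0 < norm x\<close> by (simp_all add: n_def field_simps)
    have contract: "(\<Sum>i\<in>UNIV. \<Sum>j\<in>UNIV. (a i j * w - b i j * w) * z j)
        = (\<Sum>j\<in>UNIV. ((\<Sum>i\<in>UNIV. a i j) - (\<Sum>i\<in>UNIV. b i j)) * z j) * w"
      for a b :: "3 \<Rightarrow> 3 \<Rightarrow> real" and z and w :: real
      unfolding sum_3 by (simp add: algebra_simps)
    have "(\<Sum>i\<in>UNIV. \<Sum>j\<in>UNIV. (mod1 i i j x - mod1 j i i x) * (x $ j / norm x))
        = (\<Sum>j\<in>UNIV. ((\<Sum>i\<in>UNIV. jet1 A n i i j) - (\<Sum>i\<in>UNIV. jet1 A n j i i)) * n $ j) * inverse (norm x)^2"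
      unfolding mod1_def n(2) n_def[symmetric] by (rule contract)
    also have "(\<Sum>j\<in>UNIV. ((\<Sum>i\<in>UNIV. jet1 A n i i j) - (\<Sum>i\<in>UNIV. jet1 A n j i i)) * n $ j) = n$1 + 2 * A"
      unfolding divergence_jet1[OF n(1)] trace_jet1[OF n(1)] sum_3
      by (simp add: norm_one_reduce[OF n(1)] algebra_simps)
    finally have m: "(\<Sum>i\<in>UNIV. \<Sum>j\<in>UNIV. (mod1 i i j x - mod1 j i i x) * (x $ j / norm x))
        = (n$1 + 2 * A) * inverse (norm x)^2" .
    have "(\<Sum>i\<in>UNIV. \<Sum>j\<in>UNIV.
      ((dmet g i i j x - dmet g j i i x) - (mod1 i i j x - mod1 j i i x)) * (x $ j / norm x))
      = mass_density g x - (\<Sum>i\<in>UNIV. \<Sum>j\<in>UNIV. (mod1 i i j x - mod1 j i i x) * (x $ j / norm x))"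
      unfolding mass_density_def by (simp only: left_diff_distrib sum_subtractf)
    then show "(\<Sum>i\<in>UNIV. \<Sum>j\<in>UNIV.
      ((dmet g i i j x - dmet g j i i x) - (mod1 i i j x - mod1 j i i x)) * (x $ j / norm x))
      = mass_density g x - ((x /\<^sub>R norm x)$1 + 2 * A) * inverse (norm x)^2"
      unfolding m n_def .
  qed
qed

lemma continuous_mass_density: "continuous_on (- cball 0 1) (mass_density g)"
  unfolding mass_density_def[abs_def] by (intro continuous_intros dmet_continuous) auto

text \<open>The leading mass density is (n_1 + 2 A) / r^2. Its odd part has zero mean on spheres,
  and the rest gives 4 pi (2 A) / (16 pi) = A / 2.\<close>

lemma energy_eq: "has_energy g (A / 2)"
proof -
  let ?n = "\<lambda>x::real^3. (x /\<^sub>R norm x)$1"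
  obtain C r1 where C: "\<And>x. r1 < norm x \<Longrightarrow>
      \<bar>mass_density g x - (?n x + 2 * A) * inverse (norm x)^2\<bar> \<le> C * norm x powr (- (2 + q))"
    using mass_density_approx unfolding decays_iff by blast
  have bound: "\<bar>sphere_integral \<rho> (mass_density g) - 8 * pi * A\<bar> \<le> 2 * pi\<^sup>2 * C * \<rho> powr (- q)"
    if "max 1 r1 < \<rho>" for \<rho>
  proof -
    have \<rho>: "1 < \<rho>" "r1 < \<rho>" "0 < \<rho>" using that by auto
    define w where "w = 1 / \<rho>^2"
    let ?m = "\<lambda>x. 2 * A * w + w * ?n x + 0 * ?n x ^ 2 + 0 * ?n x ^ 3"
    have m: "(?n x + 2 * A) * inverse (norm x)^2 = ?m x" if "norm x = \<rho>" for x
    proof -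
      have "inverse (norm x)^2 = w"
        by (simp add: that w_def inverse_eq_divide power_divide)
      then show ?thesis by (simp add: algebra_simps)
    qed
    have "sphere_integral \<rho> ?m = 8 * pi * A"
      unfolding sphere_integral_cubic[OF \<rho>(3)] w_def using \<rho> by simp
    moreover have "sphere_integral \<rho> (\<lambda>x. mass_density g x - ?m x)
        = sphere_integral \<rho> (mass_density g) - sphere_integral \<rho> ?m"
    proof (rule sphere_integral_diff[OF \<rho>(3)])
      have "sphere 0 \<rho> \<subseteq> - cball (0::real^3) 1" "\<forall>x\<in>sphere 0 \<rho>. norm (x::real^3) \<noteq> 0"
        using \<rho> by auto
      then show "continuous_on (sphere 0 \<rho>) (mass_density g)" "continuous_on (sphere 0 \<rho>) ?m"
        using continuous_on_subset[OF continuous_mass_density] by (auto intro!: continuous_intros)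
    qed
    moreover have "\<bar>sphere_integral \<rho> (\<lambda>x. mass_density g x - ?m x)\<bar> \<le> 2 * pi\<^sup>2 * (C * \<rho> powr (- (2 + q))) * \<rho>\<^sup>2"
    proof (rule sphere_integral_bound[OF \<rho>(3)])
      show "\<bar>mass_density g x - ?m x\<bar> \<le> C * \<rho> powr (- (2 + q))" if "norm x = \<rho>" for x
        using C[of x] m[OF that] that \<rho> by simp
      have x: "norm (\<rho> *\<^sub>R axis 1 1 :: real^3) = \<rho>"
        using \<rho> by simp
      show "0 \<le> C * \<rho> powr (- (2 + q))"
        by (rule order_trans[OF abs_ge_zero C[of "\<rho> *\<^sub>R axis 1 1", unfolded x, OF \<rho>(2)]])
    qed
    moreover have "\<rho> powr (- (2 + q)) * \<rho>\<^sup>2 = \<rho> powr (- q)"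
    proof -
      have "\<rho> powr (- (2 + q)) * \<rho> powr 2 = \<rho> powr (- q)"
        by (simp flip: powr_add)
      then show ?thesis using \<rho>(3) by simp
    qed
    ultimately show ?thesis
      by (simp add: mult.assoc)
  qed
  have "((\<lambda>\<rho>. 2 * pi\<^sup>2 * C * \<rho> powr (- q)) \<longlongrightarrow> 2 * pi\<^sup>2 * C * 0) at_top"
    using q_pos by (intro tendsto_intros tendsto_neg_powr filterlim_ident) auto
  then have "((\<lambda>\<rho>. 2 * pi\<^sup>2 * C * \<rho> powr (- q)) \<longlongrightarrow> 0) at_top"
    by simp
  moreover have "\<forall>\<^sub>F \<rho> in at_top. norm (sphere_integral \<rho> (mass_density g) - 8 * pi * A) \<le> 2 * pi\<^sup>2 * C * \<rho> powr (- q)"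
    unfolding eventually_at_top_dense real_norm_def using bound by blast
  ultimately have "((\<lambda>\<rho>. sphere_integral \<rho> (mass_density g) - 8 * pi * A) \<longlongrightarrow> 0) at_top"
    by (rule Lim_null_comparison[rotated])
  then have "((\<lambda>\<rho>. sphere_integral \<rho> (mass_density g)) \<longlongrightarrow> 8 * pi * A) at_top"
    by (rule LIM_zero_cancel)
  then have "((\<lambda>\<rho>. 1 / (16 * pi) * sphere_integral \<rho> (mass_density g)) \<longlongrightarrow> 1 / (16 * pi) * (8 * pi * A)) at_top"
    by (rule tendsto_mult_left)
  then show ?thesis
    by (simp add: has_energy_def)
qed

lemma center_integral_diverges:
  assumes "\<And>x. 1 < norm x \<Longrightarrow> scalar_curvature g x = 0" "A \<noteq> 0"
  shows "filterlim (\<lambda>\<rho>. \<bar>center_integral g 1 \<rho>\<bar>) at_top at_top"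
proof (rule center_integral_deriv_asymptotics[OF assms(1)])
  fix C r0 assume "1 \<le> r0" and C: "\<And>\<rho>. r0 < \<rho> \<Longrightarrow>
    \<bar>sphere_integral \<rho> (\<lambda>x. x$1 * curv_lin x) + 2 * pi * A / \<rho>\<bar> \<le> C * \<rho> powr (- 1 - q)"
  show ?thesis
  proof (rule logarithmic_divergence)
    show "(center_integral g 1 has_real_derivative sphere_integral \<rho> (\<lambda>x. x$1 * curv_lin x)) (at \<rho>)"
      if "r0 < \<rho>" for \<rho>
      using that \<open>1 \<le> r0\<close> by (intro center_integral_deriv) simp
    show "2 * pi * A \<noteq> 0" using assms(2) by simp
    show "\<bar>sphere_integral \<rho> (\<lambda>x. x$1 * curv_lin x) + 2 * pi * A / \<rho>\<bar> \<le> C * \<rho> powr (- 1 - q)"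
      if "r0 < \<rho>" for \<rho>
      using that by (rule C)
    show "0 < q" by (rule q_pos)
  qed
qed

end

theorem corollary3p7:
  fixes X :: "'m topology" and \<A> :: "'m chart set" and G :: "'m chart \<Rightarrow> metric_coeffs"
    and c :: "'m chart" and q A E :: real
  assumes "1/2 < q" and "q < 1"
    and "riemannian_3manifold X \<A> G"
    and "asymptotically_flat_chart X \<A> G c"
    and "scalar_flat \<A> G"
    and "has_energy (G c) E" and "E \<noteq> 0"
    and "\<forall>i j. big_O_deriv 2 (1 + q) (\<lambda>x. G c x $ i $ j
           - ((1 + A / norm x) * of_bool (i = j)
              + (x $ 1 / norm x) / norm x
                * (x $ i * x $ j / (norm x)\<^sup>2 - 1/2 * of_bool (i = j))))"
  shows "filterlim (\<lambda>\<rho>. \<bar>center_integral (G c) 1 \<rho>\<bar>) at_top at_top"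
proof -
  interpret riemannian_3manifold X \<A> G by fact
  have c: "c \<in> \<A>" and image: "chart_image c = - cball 0 1"
    using assms(4) by (auto simp: asymptotically_flat_chart_def)
  interpret asymptotic_metric "G c" A q
  proof
    show "0 < q" "q < 1" using assms(1,2) by auto
    show "Ck_on 2 (\<lambda>x. G c x $ i $ j) (- cball 0 1)" for i j
      using metric_C2[OF c] image by simp
    show "0 < v \<bullet> (G c x *v v)" if "1 < norm x" "v \<noteq> 0" for x v
      using metric_pos[OF c _ that(2)] image that(1) by simp
    \<comment> \<open>The identity is wanted at every point, so that the function inside
      \<open>big_O_deriv\<close> can be rewritten; at the origin division by zero reduces both sides
      to \<open>of_bool (i = j)\<close>.\<close>
    have "(1 + A / norm x) * of_bool (i = j) + (x $ 1 / norm x) / norm x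
          * (x $ i * x $ j / (norm x)\<^sup>2 - 1/2 * of_bool (i = j))
        = of_bool (i = j) + jet0 A (x /\<^sub>R norm x) i j * inverse (norm x)" for i j and x :: "real^3"
      unfolding jet0_def by (cases "x = 0") (simp_all add: field_simps power2_eq_square)
    then show "big_O_deriv 2 (1 + q)
        (\<lambda>x. G c x $ i $ j - of_bool (i = j) - jet0 A (x /\<^sub>R norm x) i j * inverse (norm x))" for i j
      using assms(8) by (simp add: diff_diff_eq)
  qed
  \<comment> \<open>Uniqueness of the limit identifies the given energy, so that
    \<open>E \<noteq> 0\<close> supplies the nonzero coefficient of the logarithm.\<close>
  have "E = A / 2"
    using assms(6) energy_eq tendsto_unique[OF trivial_limit_at_top_linorder]
    unfolding has_energy_def by blast
  then have "A \<noteq> 0" using \<open>E \<noteq> 0\<close> by simp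
  moreover have "scalar_curvature (G c) x = 0" if "1 < norm x" for x
    using assms(5) c image that by (auto simp: scalar_flat_def)
  ultimately show ?thesis
    by (intro center_integral_diverges)
qed

end
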